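(* Let $I\subset S$ be a nonzero proper graded ideal. Then for every $\mathfrak{p}\in\operatorname{Ass}^\infty(I)$ the function $k\mapsto \mathrm{v}_\mathfrak{p}(I^k)$ is a linear function of $k$ for $k\gg0$ (i.e. there are integers $a_\mathfrak{p},b_\mathfrak{p}$ with $\mathrm{v}_\mathfrak{p}(I^k)=a_\mathfrak{p}k+b_\mathfrak{p}$ for all $k\gg0$), and the function $k\mapsto\mathrm{v}(I^k)$ is a linear function of $k$ for $k\gg0$.
   Context: $S=K[x_1,\dots,x_n]$ is a standard graded polynomial ring over a field $K$, $S_d$ its degree-$d$ component, $\mathfrak{m}=(x_1,\dots,x_n)$. For a graded ideal $I\subset S$ and $\mathfrak{p}\in\operatorname{Ass}(I)$, the v-number of $I$ at $\mathfrak{p}$ is $\mathrm{v}_\mathfrak{p}(I)=\min\{d:\exists f\in S_d \text{ with } (I:f)=\mathfrak{p}\}$, and the v-number of $I$ is $\mathrm{v}(I)=\min\{d:\exists f\in S_d\text{ with }(I:f)\in\operatorname{Ass}(I)\}$. By Brodmann's theorem $\operatorname{Ass}(I^k)=\operatorname{Ass}(I^{k+1})$ for $k\gg0$; this eventual common set is denoted $\operatorname{Ass}^\infty(I)$ (the stable primes of $I$). *)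

theory Defs
  imports Main "HOL-Library.Poly_Mapping"
begin

text \<open>The polynomial ring S = K[x_v : v in 'v] over a field K with finitely many
variables indexed by the finite type 'v: a polynomial is a finitely supported map from
monomials (exponent vectors 'v =>0 nat) to coefficients; multiplication is convolution.\<close>

type_synonym ('v, 'k) mpoly = "('v \<Rightarrow>\<^sub>0 nat) \<Rightarrow>\<^sub>0 'k"

definition mon_deg :: "('v \<Rightarrow>\<^sub>0 nat) \<Rightarrow> nat" where
  "mon_deg m = sum (Poly_Mapping.lookup m) (Poly_Mapping.keys m)"

definition hom_comp_space :: "nat \<Rightarrow> ('v, 'k::zero) mpoly set" where
  "hom_comp_space d = {f. \<forall>m \<in> Poly_Mapping.keys f. mon_deg m = d}"

definition is_ideal :: "'a::comm_ring_1 set \<Rightarrow> bool" where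
  "is_ideal I \<longleftrightarrow> 0 \<in> I \<and> (\<forall>f\<in>I. \<forall>g\<in>I. f + g \<in> I) \<and> (\<forall>f\<in>I. \<forall>g. g * f \<in> I)"

definition ideal_gen :: "'a::comm_ring_1 set \<Rightarrow> 'a set" where
  "ideal_gen G = \<Inter>{J. is_ideal J \<and> G \<subseteq> J}"

definition graded_ideal :: "('v, 'k::field) mpoly set \<Rightarrow> bool" where
  "graded_ideal I \<longleftrightarrow> is_ideal I \<and> I = ideal_gen (I \<inter> (\<Union>d. hom_comp_space d))"

definition ideal_pow :: "'a::comm_ring_1 set \<Rightarrow> nat \<Rightarrow> 'a set" where
  "ideal_pow I k = ideal_gen {prod_list fs | fs. length fs = k \<and> set fs \<subseteq> I}"

definition colon :: "'a::comm_ring_1 set \<Rightarrow> 'a \<Rightarrow> 'a set" where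
  "colon I f = {g. g * f \<in> I}"

definition prime_ideal :: "'a::comm_ring_1 set \<Rightarrow> bool" where
  "prime_ideal P \<longleftrightarrow> is_ideal P \<and> P \<noteq> UNIV \<and> (\<forall>f g. f * g \<in> P \<longrightarrow> f \<in> P \<or> g \<in> P)"

definition Ass :: "'a::comm_ring_1 set \<Rightarrow> 'a set set" where
  "Ass I = {P. prime_ideal P \<and> (\<exists>f. colon I f = P)}"

text \<open>Stable primes: the eventual common value of Ass(I^k) (which exists by Brodmann);
rendered as the primes lying in Ass(I^k) for all sufficiently large k.\<close>
definition Ass_inf :: "'a::comm_ring_1 set \<Rightarrow> 'a set set" where
  "Ass_inf I = {P. \<exists>k0. \<forall>k\<ge>k0. P \<in> Ass (ideal_pow I k)}"

definition v_number_at :: "('v, 'k::field) mpoly set \<Rightarrow> ('v, 'k) mpoly set \<Rightarrow> nat" where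
  "v_number_at I P = (LEAST d. \<exists>f \<in> hom_comp_space d. colon I f = P)"

definition v_number :: "('v, 'k::field) mpoly set \<Rightarrow> nat" where
  "v_number I = (LEAST d. \<exists>f \<in> hom_comp_space d. colon I f \<in> Ass I)"

end

theory Submission
  imports Defs "HOL-Computational_Algebra.Polynomial" "HOL-Library.Multiset"
begin

text \<open>
  For a prime \<open>P\<close>, \<open>(I\<^sup>k : f) = P\<close> means that \<open>f\<close> lies in \<open>N\<^sub>k = (I\<^sup>k : P)\<close> but not in the ideal
  \<open>Q\<^sub>k = {f. \<exists>s \<notin> P. s f \<in> I\<^sup>k}\<close>. By Artin--Rees, applied to a nonzero element of \<open>I \<subseteq> P\<close>, there is a
  \<open>c\<close> with \<open>N\<^bsub>k+c\<^esub> \<subseteq> I\<^sup>k\<close>; hence the sum of the \<open>N\<^bsub>k+c\<^esub> t\<^sup>k\<close> is an ideal of the Noetherian Rees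
  algebra \<open>\<Oplus> I\<^sup>k t\<^sup>k\<close>, generated by finitely many bihomogeneous elements. So \<open>v\<^sub>P(I\<^sup>k)\<close> is the least
  degree of a product of generators of \<open>I\<close> with one of these elements that avoids \<open>Q\<^sub>k\<close>. Such products
  are closed under removing generators of \<open>I\<close>, and this alone forces the least degree to be eventually
  linear or undefined. Only finitely many primes occur, because they are contractions of associated
  primes in the Rees algebra; \<open>v(I\<^sup>k)\<close> is then a minimum of finitely many such functions.
\<close>

section \<open>Noetherian subrings\<close>

text \<open>The shift by c answers an obstacle: (I^k : P) need not lie in I^k, so the unshifted sum
  is only a graded submodule of S[t], while \<open>noetherian_set\<close> speaks of ideals. A
  nonzero g in I supplies the shift. If f is in (I^(k+c) : P), then f g is in I^(k+c), and
  Artin-Rees for the principal ideal (g) gives f in I^k; cancelling g is where S being a domain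
  enters.

  Passing to products of generators does not change the minimum. If a homogeneous f of degree d lies
  outside the ideal Q_k, then among the generator products of degree at most d in an expansion of f
  one must lie outside Q_k too. Removing factors keeps a product outside because I^i Q_k is
  contained in Q_(k+i). Linearity thus becomes a counting statement about down-closed sets of
  multisets.

  The outcome "undefined" is carried along because a prime may have no homogeneous witness for large
  k; it then simply drops out of the union over primes.\<close>

definition subring_set :: "'a::comm_ring_1 set \<Rightarrow> bool" where
  "subring_set A \<longleftrightarrow> 1 \<in> A \<and> (\<forall>a\<in>A. \<forall>b\<in>A. a - b \<in> A) \<and> (\<forall>a\<in>A. \<forall>b\<in>A. a * b \<in> A)"

text \<open>J may be any part of the ambient ring. Submodules inside A are the ideals of A, and A =
  \<open>UNIV\<close> gives \<open>is_ideal\<close>.\<close>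

definition submodule_of :: "'a::comm_ring_1 set \<Rightarrow> 'a set \<Rightarrow> bool" where
  "submodule_of A J \<longleftrightarrow> 0 \<in> J \<and> (\<forall>x\<in>J. \<forall>y\<in>J. x + y \<in> J) \<and> (\<forall>a\<in>A. \<forall>x\<in>J. a * x \<in> J)"

text \<open>Generation by G is expressed through minimality among all submodules of the ambient
  ring, which avoids linear combinations.\<close>

definition noetherian_set :: "'a::comm_ring_1 set \<Rightarrow> bool" where
  "noetherian_set A \<longleftrightarrow> (\<forall>J. J \<subseteq> A \<and> submodule_of A J \<longrightarrow>
     (\<exists>G. finite G \<and> G \<subseteq> J \<and> (\<forall>J'. submodule_of A J' \<and> G \<subseteq> J' \<longrightarrow> J \<subseteq> J')))"

text \<open>The image of A[X] under evaluation, so x may satisfy relations over A. One basis theorem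
  then covers polynomial rings and Rees algebras alike.\<close>

definition adjoin :: "'a::comm_ring_1 set \<Rightarrow> 'a \<Rightarrow> 'a set" where
  "adjoin A x = {poly p x | p. \<forall>i. coeff p i \<in> A}"

lemma subring_set_diff: "subring_set A \<Longrightarrow> a \<in> A \<Longrightarrow> b \<in> A \<Longrightarrow> a - b \<in> A"
  and subring_set_mult: "subring_set A \<Longrightarrow> a \<in> A \<Longrightarrow> b \<in> A \<Longrightarrow> a * b \<in> A"
  and subring_set_1: "subring_set A \<Longrightarrow> 1 \<in> A"
  by (auto simp: subring_set_def)

lemma subring_set_0: "subring_set A \<Longrightarrow> 0 \<in> A"
  using subring_set_diff[of A 1 1] subring_set_1[of A] by simp

lemma subring_set_uminus: "subring_set A \<Longrightarrow> a \<in> A \<Longrightarrow> - a \<in> A"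
  using subring_set_diff[of A 0 a] subring_set_0[of A] by simp

lemma subring_set_add: "subring_set A \<Longrightarrow> a \<in> A \<Longrightarrow> b \<in> A \<Longrightarrow> a + b \<in> A"
  using subring_set_diff[of A a "- b"] subring_set_uminus[of A b] by simp

lemma subring_set_sum: "subring_set A \<Longrightarrow> (\<And>i. i \<in> T \<Longrightarrow> f i \<in> A) \<Longrightarrow> sum f T \<in> A"
  by (induction T rule: infinite_finite_induct) (auto intro: subring_set_0 subring_set_add)

lemma subring_set_power: "subring_set A \<Longrightarrow> a \<in> A \<Longrightarrow> a ^ n \<in> A"
  by (induction n) (auto intro: subring_set_1 subring_set_mult)

lemma subring_set_UNIV: "subring_set UNIV"
  by (simp add: subring_set_def)

lemma submodule_of_0: "submodule_of A J \<Longrightarrow> 0 \<in> J"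
  and submodule_of_add: "submodule_of A J \<Longrightarrow> x \<in> J \<Longrightarrow> y \<in> J \<Longrightarrow> x + y \<in> J"
  and submodule_of_mult: "submodule_of A J \<Longrightarrow> a \<in> A \<Longrightarrow> x \<in> J \<Longrightarrow> a * x \<in> J"
  by (auto simp: submodule_of_def)

lemma submodule_of_diff:
  assumes "subring_set A" "submodule_of A J" "x \<in> J" "y \<in> J"
  shows "x - y \<in> J"
proof -
  have "- 1 * y \<in> J"
    using assms by (intro submodule_of_mult[of A J]) (auto intro: subring_set_uminus subring_set_1)
  then show ?thesis using submodule_of_add[OF assms(2,3), of "- 1 * y"] by simp
qed

lemma submodule_of_sum:
  "submodule_of A J \<Longrightarrow> (\<And>i. i \<in> T \<Longrightarrow> f i \<in> J) \<Longrightarrow> sum f T \<in> J"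
  by (induction T rule: infinite_finite_induct) (auto intro: submodule_of_0 submodule_of_add)

lemma submodule_of_Int: "submodule_of A J \<Longrightarrow> submodule_of A J' \<Longrightarrow> submodule_of A (J \<inter> J')"
  by (auto simp: submodule_of_def)

lemma is_ideal_iff_submodule: "is_ideal J \<longleftrightarrow> submodule_of UNIV J"
  by (auto simp: is_ideal_def submodule_of_def)

lemma submodule_of_Union_chain:
  assumes "\<And>n::nat. submodule_of A (J n)" "\<And>n. J n \<subseteq> J (Suc n)"
  shows "submodule_of A (\<Union>n. J n)"
proof -
  have mono: "J m \<subseteq> J n" if "m \<le> n" for m n
    using that assms(2) by (simp add: lift_Suc_mono_le)
  show ?thesis
    unfolding submodule_of_def
  proof (intro conjI ballI)
    show "0 \<in> (\<Union>n. J n)" using submodule_of_0[OF assms(1)] by blast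
  next
    fix x y assume "x \<in> (\<Union>n. J n)" "y \<in> (\<Union>n. J n)"
    then obtain m n where "x \<in> J m" "y \<in> J n" by blast
    then have "x \<in> J (max m n)" "y \<in> J (max m n)"
      using mono[of m "max m n"] mono[of n "max m n"] by auto
    then show "x + y \<in> (\<Union>n. J n)" using submodule_of_add[OF assms(1)] by blast
  next
    fix a x assume "a \<in> A" "x \<in> (\<Union>n. J n)"
    then show "a * x \<in> (\<Union>n. J n)" using submodule_of_mult[OF assms(1)] by blast
  qed
qed

lemma finite_subset_Union_chain:
  fixes J :: "nat \<Rightarrow> 'a set"
  assumes "finite G" "G \<subseteq> (\<Union>n. J n)" "\<And>n. J n \<subseteq> J (Suc n)"
  shows "\<exists>n. G \<subseteq> J n"
  using assms(1,2)
proof (induction G rule: finite_induct)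
  case (insert x G)
  then obtain m n where "G \<subseteq> J m" "x \<in> J n" by auto
  moreover have "J m \<subseteq> J (max m n)" "J n \<subseteq> J (max m n)"
    using assms(3) by (simp_all add: lift_Suc_mono_le)
  ultimately show ?case by blast
qed auto

section \<open>Noetherian induction and maximal ideals in a family\<close>

lemma noetherian_setE:
  assumes "noetherian_set A" "J \<subseteq> A" "submodule_of A J"
  obtains G where "finite G" "G \<subseteq> J" "\<And>J'. submodule_of A J' \<Longrightarrow> G \<subseteq> J' \<Longrightarrow> J \<subseteq> J'"
proof -
  have "\<exists>G. finite G \<and> G \<subseteq> J \<and> (\<forall>J'. submodule_of A J' \<and> G \<subseteq> J' \<longrightarrow> J \<subseteq> J')"
    using assms(1)[unfolded noetherian_set_def, THEN spec[of _ J]] assms(2,3) by simp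
  then show thesis by (elim exE conjE) (rule that, assumption, assumption, simp)
qed

text \<open>A failure at J would yield a strictly larger failing ideal, and dependent choice an
  infinite strict chain; but the finitely many generators of its union already lie in one
  member.\<close>

lemma noetherian_induct:
  assumes noeth: "noetherian_set A"
    and J: "J \<subseteq> A" "submodule_of A J"
    and step: "\<And>J. J \<subseteq> A \<Longrightarrow> submodule_of A J \<Longrightarrow>
      (\<And>J'. J' \<subseteq> A \<Longrightarrow> submodule_of A J' \<Longrightarrow> J \<subset> J' \<Longrightarrow> P J') \<Longrightarrow> P J"
  shows "P J"
proof (rule ccontr)
  assume "\<not> P J"
  define Q where "Q J \<longleftrightarrow> J \<subseteq> A \<and> submodule_of A J \<and> \<not> P J" for J
  have "Q J" using J \<open>\<not> P J\<close> by (simp add: Q_def)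
  moreover have "\<exists>J'. Q J' \<and> J \<subset> J'" if "Q J" for J
    using step[of J] that by (auto simp: Q_def)
  ultimately obtain F where F: "\<And>n::nat. Q (F n)" "\<And>n. F n \<subset> F (Suc n)"
    using dependent_nat_choice[of "\<lambda>_. Q" "\<lambda>_ J J'. J \<subset> J'"] by metis
  have "submodule_of A (\<Union>n. F n)"
    by (rule submodule_of_Union_chain) (use F in \<open>auto simp: Q_def\<close>)
  moreover have "(\<Union>n. F n) \<subseteq> A" using F by (auto simp: Q_def)
  ultimately obtain G where G: "finite G" "G \<subseteq> (\<Union>n. F n)"
    "\<And>J'. submodule_of A J' \<Longrightarrow> G \<subseteq> J' \<Longrightarrow> (\<Union>n. F n) \<subseteq> J'"
    using noetherian_setE[OF noeth] by metis
  obtain n where "G \<subseteq> F n"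
    using finite_subset_Union_chain[OF G(1,2)] F(2) by blast
  then have "(\<Union>n. F n) \<subseteq> F n" using G(3) F(1)[of n] by (auto simp: Q_def)
  then show False using F(2)[of n] by blast
qed

lemma noetherian_maximal:
  assumes noeth: "noetherian_set A"
    and "J \<in> F" and F: "\<And>J. J \<in> F \<Longrightarrow> J \<subseteq> A \<and> submodule_of A J"
  shows "\<exists>M\<in>F. \<forall>J\<in>F. \<not> M \<subset> J" (is ?C)
proof -
  \<comment> \<open>The claim \<open>?C\<close> does not mention J, so a member of F that is not
    maximal can hand it on to a strictly larger one.\<close>
  have "J \<in> F \<longrightarrow> ?C"
  proof (rule noetherian_induct[OF noeth, of J])
    fix J assume "\<And>J'. J' \<subseteq> A \<Longrightarrow> submodule_of A J' \<Longrightarrow> J \<subset> J' \<Longrightarrow> J' \<in> F \<longrightarrow> ?C"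
    with F show "J \<in> F \<longrightarrow> ?C" by metis
  qed (use F assms(2) in auto)
  then show ?thesis using assms(2) by blast
qed

lemma noetherian_set_field:
  assumes "\<And>a. a \<in> A \<Longrightarrow> a \<noteq> 0 \<Longrightarrow> \<exists>b\<in>A. b * a = 1"
  shows "noetherian_set A"
  unfolding noetherian_set_def
proof (intro allI impI)
  fix J assume J: "J \<subseteq> A \<and> submodule_of A J"
  show "\<exists>G. finite G \<and> G \<subseteq> J \<and> (\<forall>J'. submodule_of A J' \<and> G \<subseteq> J' \<longrightarrow> J \<subseteq> J')"
  proof (cases "J \<subseteq> {0}")
    case True
    then show ?thesis by (intro exI[of _ "{}"]) (auto dest: submodule_of_0)
  next
    case False
    then obtain a where a: "a \<in> J" "a \<noteq> 0" by blast
    obtain b where b: "b \<in> A" "b * a = 1" using assms a J by blast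
    have "J \<subseteq> J'" if J': "submodule_of A J'" "a \<in> J'" for J'
    proof
      fix x assume "x \<in> J"
      then have "x * (b * a) \<in> J'" using submodule_of_mult[OF J'(1)] b(1) J J'(2) by blast
      then show "x \<in> J'" by (simp add: b)
    qed
    then show ?thesis using a by (intro exI[of _ "{a}"]) auto
  qed
qed

section \<open>Adjoining an element and Hilbert's basis theorem\<close>

lemma subring_set_adjoin:
  assumes A: "subring_set A"
  shows "subring_set (adjoin A x)"
  unfolding subring_set_def
proof (intro conjI ballI)
  show "1 \<in> adjoin A x"
    unfolding adjoin_def using subring_set_0[OF A] subring_set_1[OF A]
    by (auto intro!: exI[of _ 1])
next
  fix a b assume "a \<in> adjoin A x" "b \<in> adjoin A x"
  then obtain p q where pq: "a = poly p x" "b = poly q x" "\<And>i. coeff p i \<in> A" "\<And>i. coeff q i \<in> A"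
    unfolding adjoin_def by blast
  have "\<forall>i. coeff (p - q) i \<in> A" "\<forall>i. coeff (p * q) i \<in> A"
    using pq A by (auto simp: coeff_mult intro!: subring_set_diff subring_set_sum subring_set_mult)
  moreover have "a - b = poly (p - q) x" "a * b = poly (p * q) x"
    using pq by simp_all
  ultimately show "a - b \<in> adjoin A x" "a * b \<in> adjoin A x"
    unfolding adjoin_def by blast+
qed

lemma subset_adjoin: "subring_set A \<Longrightarrow> A \<subseteq> adjoin A x"
proof
  fix a assume A: "subring_set A" "a \<in> A"
  have "\<forall>i. coeff [:a:] i \<in> A"
    using A subring_set_0[OF A(1)] by (auto simp: coeff_pCons split: nat.split)
  then show "a \<in> adjoin A x" unfolding adjoin_def by (auto intro!: exI[of _ "[:a:]"])
qed

lemma in_adjoin: "subring_set A \<Longrightarrow> x \<in> adjoin A x"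
proof -
  assume A: "subring_set A"
  have "\<forall>i. coeff [:0, 1:] i \<in> A"
    using subring_set_0[OF A] subring_set_1[OF A] by (auto simp: coeff_pCons split: nat.split)
  then show "x \<in> adjoin A x" unfolding adjoin_def by (auto intro!: exI[of _ "[:0,1:]"])
qed

lemma adjoin_least:
  assumes "subring_set B" "A \<subseteq> B" "x \<in> B"
  shows "adjoin A x \<subseteq> B"
  using assms unfolding adjoin_def
  by (auto simp: poly_altdef intro!: subring_set_sum subring_set_mult subring_set_power)

text \<open>Hilbert's basis theorem: nested ideals of \<open>A[x]\<close> with the same ideals of leading coefficients
  in every degree coincide, and these ideals of \<open>A\<close> stabilise as the degree grows.\<close>

definition lead_coeffs :: "'a::comm_ring_1 set \<Rightarrow> 'a \<Rightarrow> 'a set \<Rightarrow> nat \<Rightarrow> 'a set" where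
  "lead_coeffs A x J n = {coeff p n | p. (\<forall>i. coeff p i \<in> A) \<and> degree p \<le> n \<and> poly p x \<in> J}"

lemma lead_coeffs_subset: "lead_coeffs A x J n \<subseteq> A"
  by (auto simp: lead_coeffs_def)

lemma submodule_lead_coeffs:
  assumes A: "subring_set A" and J: "submodule_of (adjoin A x) J"
  shows "submodule_of A (lead_coeffs A x J n)"
  unfolding submodule_of_def
proof (intro conjI ballI)
  show "0 \<in> lead_coeffs A x J n"
    unfolding lead_coeffs_def using subring_set_0[OF A] submodule_of_0[OF J]
    by (auto intro!: exI[of _ 0])
next
  fix a b assume "a \<in> lead_coeffs A x J n" "b \<in> lead_coeffs A x J n"
  then obtain p q where "a = coeff p n" "b = coeff q n" "\<forall>i. coeff p i \<in> A" "\<forall>i. coeff q i \<in> A"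
    "degree p \<le> n" "degree q \<le> n" "poly p x \<in> J" "poly q x \<in> J"
    unfolding lead_coeffs_def by blast
  then show "a + b \<in> lead_coeffs A x J n"
    unfolding lead_coeffs_def
    by (auto intro!: exI[of _ "p + q"] subring_set_add[OF A] degree_add_le submodule_of_add[OF J])
next
  fix a b assume a: "a \<in> A" and "b \<in> lead_coeffs A x J n"
  then obtain q where q: "b = coeff q n" "\<forall>i. coeff q i \<in> A" "degree q \<le> n" "poly q x \<in> J"
    unfolding lead_coeffs_def by blast
  have "a \<in> adjoin A x" using a subset_adjoin[OF A] by blast
  then have "poly (smult a q) x \<in> J" using submodule_of_mult[OF J] q by simp
  moreover have "degree (smult a q) \<le> n" using q degree_smult_le[of a q] by linarith
  ultimately show "a * b \<in> lead_coeffs A x J n"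
    unfolding lead_coeffs_def using q a
    by (auto intro!: exI[of _ "smult a q"] subring_set_mult[OF A])
qed

lemma lead_coeffs_Suc:
  assumes A: "subring_set A" and J: "submodule_of (adjoin A x) J"
  shows "lead_coeffs A x J n \<subseteq> lead_coeffs A x J (Suc n)"
proof
  fix a assume "a \<in> lead_coeffs A x J n"
  then obtain p where p: "a = coeff p n" "\<forall>i. coeff p i \<in> A" "degree p \<le> n" "poly p x \<in> J"
    unfolding lead_coeffs_def by blast
  have "poly (pCons 0 p) x \<in> J"
    using submodule_of_mult[OF J in_adjoin[OF A] p(4)] by simp
  moreover have "\<forall>i. coeff (pCons 0 p) i \<in> A"
    using p(2) subring_set_0[OF A] by (auto simp: coeff_pCons split: nat.split)
  moreover have "degree (pCons 0 p) \<le> Suc n" using p(3) degree_pCons_le[of 0 p] by linarith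
  ultimately show "a \<in> lead_coeffs A x J (Suc n)"
    unfolding lead_coeffs_def using p(1) by (auto intro!: exI[of _ "pCons 0 p"])
qed

text \<open>Subtracting a q whose value at x lies in J and J' and which agrees with p in the
  coefficient at n leaves 0 or a polynomial of smaller degree with value still in J, so induction on
  the degree bound applies.\<close>

lemma subset_if_lead_coeffs_subset:
  assumes A: "subring_set A" and J: "J \<subseteq> adjoin A x" "submodule_of (adjoin A x) J"
    and J': "submodule_of (adjoin A x) J'"
    and sub: "\<And>n. lead_coeffs A x J n \<subseteq> lead_coeffs A x (J \<inter> J') n"
  shows "J \<subseteq> J'"
proof -
  note Ax = subring_set_adjoin[OF A, of x]
  have "poly p x \<in> J'" if "\<forall>i. coeff p i \<in> A" "degree p \<le> n" "poly p x \<in> J" for p n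
    using that
  proof (induction n arbitrary: p rule: less_induct)
    case (less n)
    have "coeff p n \<in> lead_coeffs A x J n"
      unfolding lead_coeffs_def using less.prems by blast
    then obtain q where q: "coeff p n = coeff q n" "\<forall>i. coeff q i \<in> A" "degree q \<le> n"
      "poly q x \<in> J" "poly q x \<in> J'"
      using sub unfolding lead_coeffs_def by blast
    have cA: "\<forall>i. coeff (p - q) i \<in> A" using less.prems(1) q(2) subring_set_diff[OF A] by simp
    have inJ: "poly (p - q) x \<in> J" using submodule_of_diff[OF Ax J(2) less.prems(3) q(4)] by simp
    have "poly (p - q) x \<in> J'"
    proof (cases "p - q = 0")
      case True
      then show ?thesis using submodule_of_0[OF J'] by simp
    next
      case False
      have "degree (p - q) \<le> n" using less.prems(2) q(3) by (simp add: degree_diff_le)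
      moreover have "degree (p - q) \<noteq> n"
        using False q(1) leading_coeff_0_iff[of "p - q"] by force
      ultimately show ?thesis using less.IH[of "degree (p - q)" "p - q"] cA inJ by auto
    qed
    then have "poly (p - q) x + poly q x \<in> J'" using submodule_of_add[OF J'] q(5) by blast
    then show ?case by simp
  qed
  then show ?thesis using J(1) unfolding adjoin_def by blast
qed

lemma noetherian_adjoin:
  assumes A: "subring_set A" and noeth: "noetherian_set A"
  shows "noetherian_set (adjoin A x)"
  unfolding noetherian_set_def
proof (intro allI impI)
  fix J assume "J \<subseteq> adjoin A x \<and> submodule_of (adjoin A x) J"
  then have J: "J \<subseteq> adjoin A x" "submodule_of (adjoin A x) J" by auto
  define L where "L = lead_coeffs A x J"
  have L: "submodule_of A (L n)" "L n \<subseteq> A" "L n \<subseteq> L (Suc n)" for n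
    unfolding L_def
    using submodule_lead_coeffs[OF A J(2)] lead_coeffs_subset[of A x J] lead_coeffs_Suc[OF A J(2)]
    by auto
  have "\<exists>G. finite G \<and> G \<subseteq> L n \<and> (\<forall>J'. submodule_of A J' \<and> G \<subseteq> J' \<longrightarrow> L n \<subseteq> J')" for n
    by (rule noetherian_setE[OF noeth L(2)[of n] L(1)[of n]]) blast
  then obtain G where G: "\<And>n. finite (G n)" "\<And>n. G n \<subseteq> L n"
    "\<And>n J'. submodule_of A J' \<Longrightarrow> G n \<subseteq> J' \<Longrightarrow> L n \<subseteq> J'" by metis
  have "submodule_of A (\<Union>n. L n)" using submodule_of_Union_chain L by blast
  moreover have "(\<Union>n. L n) \<subseteq> A" using L(2) by blast
  ultimately obtain G' where G': "finite G'" "G' \<subseteq> (\<Union>n. L n)"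
    "\<And>J'. submodule_of A J' \<Longrightarrow> G' \<subseteq> J' \<Longrightarrow> (\<Union>n. L n) \<subseteq> J'"
    using noetherian_setE[OF noeth] by metis
  obtain n0 where "G' \<subseteq> L n0" using finite_subset_Union_chain[OF G'(1,2)] L(3) by blast
  then have stable: "L n \<subseteq> L n0" for n using G'(3)[OF L(1), of n0] by blast
  have "\<exists>p. a = coeff p n \<and> (\<forall>i. coeff p i \<in> A) \<and> degree p \<le> n \<and> poly p x \<in> J"
    if "a \<in> G n" for a n
    using G(2) that unfolding L_def lead_coeffs_def by blast
  then obtain p where p: "\<And>a n. a \<in> G n \<Longrightarrow> a = coeff (p a n) n"
    "\<And>a n i. a \<in> G n \<Longrightarrow> coeff (p a n) i \<in> A" "\<And>a n. a \<in> G n \<Longrightarrow> degree (p a n) \<le> n"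
    "\<And>a n. a \<in> G n \<Longrightarrow> poly (p a n) x \<in> J" by metis
  \<comment> \<open>Lifted generators for n up to n0 suffice: L gains nothing above n0, and the
    chain belonging to the intersection of J and J' increases, so inclusion at n0 carries over to
    larger n.\<close>
  define H where "H = (\<Union>n\<le>n0. (\<lambda>a. poly (p a n) x) ` G n)"
  have "J \<subseteq> J'" if J': "submodule_of (adjoin A x) J'" "H \<subseteq> J'" for J'
  proof (rule subset_if_lead_coeffs_subset[OF A J J'(1)])
    note JJ' = submodule_of_Int[OF J(2) J'(1)]
    have low: "L n \<subseteq> lead_coeffs A x (J \<inter> J') n" if "n \<le> n0" for n
    proof (rule G(3)[OF submodule_lead_coeffs[OF A JJ']], rule subsetI)
      fix a assume a: "a \<in> G n"
      then have "poly (p a n) x \<in> J'" using J'(2) that unfolding H_def by blast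
      then show "a \<in> lead_coeffs A x (J \<inter> J') n"
        unfolding lead_coeffs_def using p[OF a] by blast
    qed
    fix n
    show "lead_coeffs A x J n \<subseteq> lead_coeffs A x (J \<inter> J') n"
    proof (cases "n \<le> n0")
      case True
      then show ?thesis using low L_def by simp
    next
      case False
      then have "lead_coeffs A x (J \<inter> J') n0 \<subseteq> lead_coeffs A x (J \<inter> J') n"
        using lead_coeffs_Suc[OF A JJ'] by (simp add: lift_Suc_mono_le)
      then show ?thesis using stable[of n] low[of n0] L_def by blast
    qed
  qed
  moreover have "finite H" "H \<subseteq> J" unfolding H_def using G(1) p(4) by auto
  ultimately show "\<exists>G. finite G \<and> G \<subseteq> J \<and> (\<forall>J'. submodule_of (adjoin A x) J' \<and> G \<subseteq> J' \<longrightarrow> J \<subseteq> J')"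
    by blast
qed

text \<open>Each element of X costs one application of the basis theorem. The minimality clause
  later bounds B from above by the Rees algebra.\<close>

lemma noetherian_finitely_generated:
  assumes A: "subring_set A" and noeth: "noetherian_set A" and "finite X"
  shows "\<exists>B. subring_set B \<and> noetherian_set B \<and> A \<union> X \<subseteq> B \<and>
    (\<forall>C. subring_set C \<and> A \<union> X \<subseteq> C \<longrightarrow> B \<subseteq> C)"
  using assms(3)
proof (induction X rule: finite_induct)
  case empty
  then show ?case using A noeth by auto
next
  case (insert x X)
  then obtain B where B: "subring_set B" "noetherian_set B" "A \<union> X \<subseteq> B"
    "\<And>C. subring_set C \<Longrightarrow> A \<union> X \<subseteq> C \<Longrightarrow> B \<subseteq> C" by (elim exE conjE) simp
  show ?case
  proof (intro exI[of _ "adjoin B x"] conjI allI impI)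
    show "A \<union> insert x X \<subseteq> adjoin B x"
      using B(3) subset_adjoin[OF B(1), of x] in_adjoin[OF B(1), of x] by blast
    fix C assume "subring_set C \<and> A \<union> insert x X \<subseteq> C"
    then show "adjoin B x \<subseteq> C" using adjoin_least[of C B x] B(4)[of C] by blast
  qed (use B noetherian_adjoin subring_set_adjoin in auto)
qed

section \<open>Finiteness of contracted associated primes\<close>

lemma submodule_of_add_multiples:
  assumes R: "subring_set R" and J: "submodule_of R J"
  shows "submodule_of R {j + r * y | j r. j \<in> J \<and> r \<in> R}"
  unfolding submodule_of_def
proof (intro conjI ballI)
  show "0 \<in> {j + r * y | j r. j \<in> J \<and> r \<in> R}"
    using submodule_of_0[OF J] subring_set_0[OF R] by force
next
  fix u v assume "u \<in> {j + r * y | j r. j \<in> J \<and> r \<in> R}" "v \<in> {j + r * y | j r. j \<in> J \<and> r \<in> R}"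
  then obtain j r j' r' where *: "u = j + r * y" "v = j' + r' * y" "j \<in> J" "j' \<in> J" "r \<in> R" "r' \<in> R"
    by blast
  have "u + v = (j + j') + (r + r') * y" using * by (simp add: algebra_simps)
  then show "u + v \<in> {j + r * y | j r. j \<in> J \<and> r \<in> R}"
    using submodule_of_add[OF J *(3,4)] subring_set_add[OF R *(5,6)] by blast
next
  fix a u assume a: "a \<in> R" and "u \<in> {j + r * y | j r. j \<in> J \<and> r \<in> R}"
  then obtain j r where *: "u = j + r * y" "j \<in> J" "r \<in> R" by blast
  have "a * u = a * j + (a * r) * y" using * by (simp add: algebra_simps)
  then show "a * u \<in> {j + r * y | j r. j \<in> J \<and> r \<in> R}"
    using submodule_of_mult[OF J a *(2)] subring_set_mult[OF R a *(3)] by blast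
qed

text \<open>Existence of an associated prime of R/J: take (J : y) maximal among the colons with y
  outside J. If s y is outside J, then (J : s y) contains (J : y), hence equals it.\<close>

lemma exists_prime_colon:
  assumes R: "subring_set R" and noeth: "noetherian_set R"
    and J: "J \<subseteq> R" "submodule_of R J" "J \<noteq> R"
  shows "\<exists>y\<in>R. y \<notin> J \<and> (\<forall>r\<in>R. \<forall>s\<in>R. r * s * y \<in> J \<longrightarrow> r * y \<in> J \<or> s * y \<in> J)"
proof -
  define col where "col y = {r\<in>R. r * y \<in> J}" for y
  have col: "col y \<subseteq> R \<and> submodule_of R (col y)" for y
    using submodule_of_0[OF J(2)] submodule_of_add[OF J(2)] submodule_of_mult[OF J(2)]
      subring_set_0[OF R] subring_set_add[OF R] subring_set_mult[OF R]
    by (auto simp: col_def submodule_of_def distrib_right mult.assoc)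
  obtain y where "y \<in> R - J" using J by blast
  then have "\<exists>M\<in>col ` (R - J). \<forall>N\<in>col ` (R - J). \<not> M \<subset> N"
    using col by (intro noetherian_maximal[OF noeth, of "col y"]) auto
  then obtain y where y: "y \<in> R" "y \<notin> J" and max: "\<And>z. z \<in> R - J \<Longrightarrow> \<not> col y \<subset> col z"
    by blast
  have "r * y \<in> J" if rs: "r \<in> R" "s \<in> R" "r * s * y \<in> J" "s * y \<notin> J" for r s
  proof -
    have "s * y \<in> R - J" using rs subring_set_mult[OF R] y by blast
    moreover have "col y \<subseteq> col (s * y)"
      using submodule_of_mult[OF J(2) rs(2)] by (auto simp: col_def mult.left_commute[of _ s])
    ultimately have "col (s * y) = col y" using max by blast
    moreover have "r \<in> col (s * y)" using rs by (simp add: col_def mult.assoc)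
    ultimately show ?thesis by (simp add: col_def)
  qed
  then show ?thesis using y by blast
qed

text \<open>In the exact sequence
  \<open>0 \<rightarrow> R/(J:y) \<rightarrow> R/J \<rightarrow> R/(J + Ry) \<rightarrow> 0\<close> with \<open>(J:y)\<close> prime, the first term
  contributes only the contraction of \<open>(J:y)\<close>.\<close>

lemma finite_contracted_ass:
  fixes R :: "'a::comm_ring_1 poly set"
  assumes R: "subring_set R" "\<And>s. [:s:] \<in> R" and noeth: "noetherian_set R"
    and J: "J \<subseteq> R" "submodule_of R J"
  shows "finite {P. prime_ideal P \<and> (\<exists>y\<in>R. P = {s. [:s:] * y \<in> J})}"
    (is "finite (?F J)")
  using noeth J
proof (rule noetherian_induct)
  fix J assume J: "J \<subseteq> R" "submodule_of R J"
    and IH: "\<And>J'. J' \<subseteq> R \<Longrightarrow> submodule_of R J' \<Longrightarrow> J \<subset> J' \<Longrightarrow> finite (?F J')"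
  show "finite (?F J)"
  proof (cases "J = R")
    case True
    have "\<not> prime_ideal P" if "y \<in> R" "P = {s. [:s:] * y \<in> J}" for P y
      using that True subring_set_mult[OF R(1) R(2)] by (auto simp: prime_ideal_def)
    then have "?F J = {}" by blast
    then show ?thesis by (simp only: finite.emptyI)
  next
    case False
    then obtain y where y: "y \<in> R" "y \<notin> J"
      and prime: "\<And>r s. r \<in> R \<Longrightarrow> s \<in> R \<Longrightarrow> r * s * y \<in> J \<Longrightarrow> r * y \<in> J \<or> s * y \<in> J"
      using exists_prime_colon[OF R(1) noeth J] by blast
    define J' where "J' = {j + r * y | j r. j \<in> J \<and> r \<in> R}"
    have sub: "submodule_of R J'" unfolding J'_def by (rule submodule_of_add_multiples[OF R(1) J(2)])
    have "J' \<subseteq> R"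
      using J(1) y(1) subring_set_add[OF R(1)] subring_set_mult[OF R(1)] unfolding J'_def by blast
    have "J \<subseteq> J'"
    proof
      fix j assume "j \<in> J"
      moreover have "j = j + 0 * y" by simp
      ultimately show "j \<in> J'" unfolding J'_def using subring_set_0[OF R(1)] by blast
    qed
    have "y = 0 + 1 * y" by simp
    then have "y \<in> J'" unfolding J'_def using submodule_of_0[OF J(2)] subring_set_1[OF R(1)] by blast
    then have fin: "finite (?F J')"
      using IH[OF \<open>J' \<subseteq> R\<close> sub] \<open>J \<subseteq> J'\<close> y(2) by blast
    have "?F J \<subseteq> insert {s. [:s:] * y \<in> J} (?F J')"
    proof
      fix P assume "P \<in> ?F J"
      then obtain z where P: "prime_ideal P" and z: "z \<in> R" "P = {s. [:s:] * z \<in> J}" by blast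
      show "P \<in> insert {s. [:s:] * y \<in> J} (?F J')"
      \<comment> \<open>Either every multiple of z by a constant that lies in J' is already in J,
        and P keeps its description over J', or some multiple s z lies in J' but not in J, and P is
        the contraction of (J : y).\<close>
      proof (cases "\<forall>s. [:s:] * z \<in> J' \<longrightarrow> [:s:] * z \<in> J")
        case True
        then have "P = {s. [:s:] * z \<in> J'}" using z(2) \<open>J \<subseteq> J'\<close> by blast
        then show ?thesis using P z(1) by blast
      next
        case False
        then obtain s j r where s: "[:s:] * z = j + r * y" "[:s:] * z \<notin> J" "j \<in> J" "r \<in> R"
          unfolding J'_def by blast
        have "s \<notin> P" using s(2) z(2) by simp
        have ry: "r * y \<notin> J" using s submodule_of_add[OF J(2)] by auto
        \<comment> \<open>Replace z by s z, which keeps the contracted colon because s is outside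
          the prime P; then s z by r y, which differs from it by j in J; then r y by y, since (J :
          y) is prime and omits r.\<close>
        have "u \<in> P \<longleftrightarrow> [:u:] * y \<in> J" for u
        proof -
          have "u \<in> P \<longleftrightarrow> u * s \<in> P"
            using P \<open>s \<notin> P\<close> unfolding prime_ideal_def is_ideal_def by (metis mult.commute)
          also have "\<dots> \<longleftrightarrow> [:u:] * ([:s:] * z) \<in> J"
            by (simp add: z(2) mult.assoc[symmetric] ac_simps)
          also have "\<dots> \<longleftrightarrow> [:u:] * j + [:u:] * (r * y) \<in> J" by (simp only: s(1) distrib_left)
          also have "\<dots> \<longleftrightarrow> [:u:] * (r * y) \<in> J"
          proof -
            have uj: "[:u:] * j \<in> J" using submodule_of_mult[OF J(2) R(2) s(3)] .
            show ?thesis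
              using submodule_of_add[OF J(2) uj] submodule_of_diff[OF R(1) J(2) _ uj]
              by (metis add_diff_cancel_left')
          qed
          also have "\<dots> \<longleftrightarrow> [:u:] * y \<in> J"
          proof
            assume "[:u:] * (r * y) \<in> J"
            then show "[:u:] * y \<in> J"
              using prime[OF R(2)[of u] s(4)] ry by (simp only: mult.assoc) blast
          next
            assume "[:u:] * y \<in> J"
            then have "r * ([:u:] * y) \<in> J" using submodule_of_mult[OF J(2) s(4)] by blast
            then show "[:u:] * (r * y) \<in> J" by (simp only: mult.left_commute)
          qed
          finally show ?thesis .
        qed
        then show ?thesis by blast
      qed
    qed
    then show ?thesis using fin finite_subset by blast
  qed
qed

section \<open>Powers of ideals and the Rees algebra\<close>

lemma is_ideal_ideal_gen: "is_ideal (ideal_gen G)"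
  by (auto simp: ideal_gen_def is_ideal_def)

lemma subset_ideal_gen: "G \<subseteq> ideal_gen G"
  by (auto simp: ideal_gen_def)

lemma ideal_gen_base: "x \<in> G \<Longrightarrow> x \<in> ideal_gen G"
  using subset_ideal_gen by (rule subsetD)

lemma ideal_gen_least: "is_ideal J \<Longrightarrow> G \<subseteq> J \<Longrightarrow> ideal_gen G \<subseteq> J"
  by (auto simp: ideal_gen_def)

lemma ideal_gen_mono: "G \<subseteq> H \<Longrightarrow> ideal_gen G \<subseteq> ideal_gen H"
  by (auto simp: ideal_gen_def)

lemma is_ideal_0: "is_ideal J \<Longrightarrow> 0 \<in> J"
  and is_ideal_add: "is_ideal J \<Longrightarrow> x \<in> J \<Longrightarrow> y \<in> J \<Longrightarrow> x + y \<in> J"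
  and is_ideal_mult_left: "is_ideal J \<Longrightarrow> x \<in> J \<Longrightarrow> a * x \<in> J"
  by (auto simp: is_ideal_def)

lemma is_ideal_mult_right: "is_ideal J \<Longrightarrow> x \<in> J \<Longrightarrow> x * a \<in> J"
  using is_ideal_mult_left[of J x a] by (simp add: mult.commute)

lemma is_ideal_sum: "is_ideal J \<Longrightarrow> (\<And>i. i \<in> T \<Longrightarrow> f i \<in> J) \<Longrightarrow> sum f T \<in> J"
  by (simp add: is_ideal_iff_submodule submodule_of_sum)

lemma is_ideal_diff: "is_ideal J \<Longrightarrow> x \<in> J \<Longrightarrow> y \<in> J \<Longrightarrow> x - y \<in> J"
  using submodule_of_diff[OF subring_set_UNIV] by (simp add: is_ideal_iff_submodule)

lemma is_ideal_colon: "is_ideal J \<Longrightarrow> is_ideal (colon J f)"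
  by (auto simp: is_ideal_def colon_def distrib_right mult.assoc)

lemma is_ideal_colon_set: "is_ideal J \<Longrightarrow> is_ideal {y. \<forall>p\<in>P. p * y \<in> J}"
  by (auto simp: is_ideal_def distrib_left mult.left_commute)

text \<open>One factor is fixed at a time: the admissible other factors then form a colon ideal, so
  testing generators is enough.\<close>

lemma ideal_gen_mult:
  assumes "f \<in> ideal_gen X" "g \<in> ideal_gen Y" "is_ideal J"
    and "\<And>x y. x \<in> X \<Longrightarrow> y \<in> Y \<Longrightarrow> x * y \<in> J"
  shows "f * g \<in> J"
proof -
  have "f * y \<in> J" if "y \<in> Y" for y
    using ideal_gen_least[OF is_ideal_colon[OF assms(3), of y], of X] assms(1,4) that
    unfolding colon_def by blast
  then have "Y \<subseteq> colon J f" by (auto simp: colon_def mult.commute)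
  then have "g \<in> colon J f"
    using ideal_gen_least[OF is_ideal_colon[OF assms(3)]] assms(2) by blast
  then show ?thesis by (simp add: colon_def mult.commute)
qed

lemma is_ideal_pow: "is_ideal (ideal_pow I k)"
  by (simp add: ideal_pow_def is_ideal_ideal_gen)

lemma prod_list_in_ideal_pow: "set fs \<subseteq> I \<Longrightarrow> prod_list fs \<in> ideal_pow I (length fs)"
  unfolding ideal_pow_def by (rule ideal_gen_base) blast

lemma ideal_pow_0: "ideal_pow I 0 = UNIV"
proof -
  have "1 \<in> ideal_pow I 0" using prod_list_in_ideal_pow[of "[]" I] by simp
  then show ?thesis using is_ideal_mult_left[OF is_ideal_pow, of 1 I 0] by auto
qed

lemma ideal_pow_mult:
  assumes "f \<in> ideal_pow I j" "g \<in> ideal_pow I k"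
  shows "f * g \<in> ideal_pow I (j + k)"
proof (rule ideal_gen_mult[OF assms[unfolded ideal_pow_def] is_ideal_pow])
  fix x y assume "x \<in> {prod_list fs |fs. length fs = j \<and> set fs \<subseteq> I}"
    "y \<in> {prod_list fs |fs. length fs = k \<and> set fs \<subseteq> I}"
  then obtain fs gs where "x = prod_list fs" "y = prod_list gs" "length fs = j" "length gs = k"
    "set fs \<subseteq> I" "set gs \<subseteq> I" by blast
  then show "x * y \<in> ideal_pow I (j + k)" using prod_list_in_ideal_pow[of "fs @ gs" I] by simp
qed

lemma subset_ideal_pow_1: "I \<subseteq> ideal_pow I 1"
  using prod_list_in_ideal_pow[of "[_]" I] by auto

lemma ideal_pow_mult_Suc: "f \<in> I \<Longrightarrow> g \<in> ideal_pow I k \<Longrightarrow> f * g \<in> ideal_pow I (Suc k)"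
  using ideal_pow_mult[of f I 1 g k] subset_ideal_pow_1[of I] by auto

lemma ideal_pow_antimono: "j \<le> k \<Longrightarrow> ideal_pow I k \<subseteq> ideal_pow I j"
proof (induction rule: dec_induct)
  case (step k)
  have "ideal_pow I (Suc k) \<subseteq> ideal_pow I k"
    unfolding ideal_pow_def[of I "Suc k"]
  proof (rule ideal_gen_least[OF is_ideal_pow], rule subsetI)
    fix x assume "x \<in> {prod_list fs |fs. length fs = Suc k \<and> set fs \<subseteq> I}"
    then obtain f fs where "x = f * prod_list fs" "length fs = k" "set fs \<subseteq> I"
      by (auto simp: length_Suc_conv)
    then show "x \<in> ideal_pow I k"
      using is_ideal_mult_left[OF is_ideal_pow, of "prod_list fs" I k f]
        prod_list_in_ideal_pow[of fs I] by simp
  qed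
  then show ?case using step by blast
qed auto

lemma prod_mset_in_ideal_pow: "set_mset A \<subseteq> I \<Longrightarrow> prod_mset A \<in> ideal_pow I (size A)"
  by (induction A) (auto simp: ideal_pow_0 intro: ideal_pow_mult_Suc)

text \<open>Multisets rather than lists make the removal of a generator a passage to a submultiset,
  on which the counting argument rests.\<close>

lemma ideal_pow_generators:
  assumes "I = ideal_gen G"
  shows "ideal_pow I k = ideal_gen {prod_mset A | A. set_mset A \<subseteq> G \<and> size A = k}"
    (is "_ = ideal_gen (?H k)")
proof
  have "prod_list fs \<in> ideal_gen (?H (length fs))" if "set fs \<subseteq> I" for fs
    using that
  proof (induction fs)
    case Nil
    have "prod_mset {#} \<in> ?H 0" by force
    then show ?case using ideal_gen_base[of 1 "?H 0"] by simp
  next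
    case (Cons f fs)
    have "f \<in> ideal_gen G" "prod_list fs \<in> ideal_gen (?H (length fs))"
      using Cons assms by auto
    then have "f * prod_list fs \<in> ideal_gen (?H (Suc (length fs)))"
    proof (rule ideal_gen_mult[OF _ _ is_ideal_ideal_gen])
      fix x y assume "x \<in> G" "y \<in> ?H (length fs)"
      then obtain A where A: "y = prod_mset A" "set_mset A \<subseteq> G" "size A = length fs" by blast
      have "x * y = prod_mset (add_mset x A)" "set_mset (add_mset x A) \<subseteq> G"
        "size (add_mset x A) = Suc (length fs)" using A \<open>x \<in> G\<close> by auto
      then have "x * y \<in> ?H (Suc (length fs))" by blast
      then show "x * y \<in> ideal_gen (?H (Suc (length fs)))" by (rule ideal_gen_base)
    qed
    then show ?case by simp
  qed
  then show "ideal_pow I k \<subseteq> ideal_gen (?H k)"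
    unfolding ideal_pow_def by (intro ideal_gen_least[OF is_ideal_ideal_gen] subsetI) force
  have "G \<subseteq> I" using assms subset_ideal_gen by blast
  then have "prod_mset A \<in> ideal_pow I k" if "set_mset A \<subseteq> G" "size A = k" for A
    using prod_mset_in_ideal_pow[of A I] that by auto
  then show "ideal_gen (?H k) \<subseteq> ideal_pow I k"
    by (intro ideal_gen_least[OF is_ideal_pow]) auto
qed

section \<open>The Rees algebra and its graded ideals\<close>

definition rees :: "'a::comm_ring_1 set \<Rightarrow> 'a poly set" where
  "rees I = {p. \<forall>k. coeff p k \<in> ideal_pow I k}"

lemma subring_set_rees: "subring_set (rees I)"
  unfolding subring_set_def
proof (intro conjI ballI)
  show "1 \<in> rees I"
    by (simp add: rees_def coeff_1 ideal_pow_0 is_ideal_0[OF is_ideal_pow])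
next
  fix p q assume pq: "p \<in> rees I" "q \<in> rees I"
  then show "p - q \<in> rees I"
    by (simp add: rees_def is_ideal_diff[OF is_ideal_pow])
  have "coeff p i * coeff q (k - i) \<in> ideal_pow I k" if "i \<le> k" for i k
    using ideal_pow_mult[of "coeff p i" I i "coeff q (k - i)" "k - i"] pq that
    by (simp add: rees_def)
  then show "p * q \<in> rees I"
    by (auto simp: rees_def coeff_mult intro!: is_ideal_sum is_ideal_pow)
qed

lemma const_in_rees: "[:s:] \<in> rees I"
  by (simp add: rees_def coeff_pCons ideal_pow_0 is_ideal_0[OF is_ideal_pow] split: nat.split)

lemma monom_in_rees: "y \<in> ideal_pow I k \<Longrightarrow> monom y k \<in> rees I"
  by (simp add: rees_def is_ideal_0[OF is_ideal_pow])

text \<open>Since B contains the constants, the y with \<open>monom y k\<close> in B form an ideal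
  for each k; products of the g t then force all of I^k t^k into B.\<close>

lemma rees_least:
  assumes B: "subring_set B" and const: "\<And>s. [:s:] \<in> B"
    and I: "I = ideal_gen G" and G: "\<And>g. g \<in> G \<Longrightarrow> monom g 1 \<in> B"
  shows "rees I \<subseteq> B"
proof -
  have smult: "smult s p \<in> B" if "p \<in> B" for s p
    using subring_set_mult[OF B const[of s] that] by simp
  have ideal: "is_ideal {y. monom y k \<in> B}" for k
    using subring_set_0[OF B] subring_set_add[OF B] smult
    by (auto simp: is_ideal_def add_monom[symmetric] simp flip: smult_monom)
  have one: "monom f 1 \<in> B" if "f \<in> I" for f
    using ideal_gen_least[OF ideal[of 1], of G] that I G by blast
  have "monom (prod_list fs) (length fs) \<in> B" if "set fs \<subseteq> I" for fs
    using that
  proof (induction fs)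
    case Nil
    then show ?case using subring_set_1[OF B] by (simp add: monom_0 one_pCons)
  next
    case (Cons f fs)
    then have "monom f 1 * monom (prod_list fs) (length fs) \<in> B"
      using subring_set_mult[OF B] one by simp
    then show ?case by (simp add: mult_monom)
  qed
  then have "ideal_pow I k \<subseteq> {y. monom y k \<in> B}" for k
    unfolding ideal_pow_def by (intro ideal_gen_least[OF ideal]) auto
  then have mon: "monom y k \<in> B" if "y \<in> ideal_pow I k" for y k
    using that by blast
  show ?thesis
  proof
    fix p assume p: "p \<in> rees I"
    have "(\<Sum>k\<le>degree p. monom (coeff p k) k) \<in> B"
      using p mon by (intro subring_set_sum[OF B]) (auto simp: rees_def)
    then show "p \<in> B" by (simp add: poly_as_sum_of_monoms)
  qed
qed

lemma noetherian_UNIV_if_generated: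
  fixes F X :: "'a::comm_ring_1 set"
  assumes F: "subring_set F" "\<And>a. a \<in> F \<Longrightarrow> a \<noteq> 0 \<Longrightarrow> \<exists>b\<in>F. b * a = 1"
    and X: "finite X" and gen: "\<And>B. subring_set B \<Longrightarrow> F \<union> X \<subseteq> B \<Longrightarrow> B = UNIV"
  shows "noetherian_set (UNIV :: 'a set)"
proof -
  have "noetherian_set F" by (rule noetherian_set_field) (rule F(2))
  then obtain B where "subring_set B" "noetherian_set B" "F \<union> X \<subseteq> B"
    using noetherian_finitely_generated[OF F(1) _ X] by metis
  then show ?thesis using gen[of B] by simp
qed

text \<open>As X generates the ring over the field F, the Rees algebra is generated over F by X and
  the finitely many g t with g in G.\<close>

lemma noetherian_rees:
  fixes F X I :: "'a::comm_ring_1 set"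
  assumes F: "subring_set F" "\<And>a. a \<in> F \<Longrightarrow> a \<noteq> 0 \<Longrightarrow> \<exists>b\<in>F. b * a = 1"
    and X: "finite X" and gen: "\<And>B. subring_set B \<Longrightarrow> F \<union> X \<subseteq> B \<Longrightarrow> B = UNIV"
    and I: "I = ideal_gen G" and G: "finite G"
  shows "noetherian_set (rees I)"
proof -
  define F' where "F' = (\<lambda>s. [:s:]) ` F"
  define X' where "X' = (\<lambda>s. [:s:]) ` X \<union> (\<lambda>g. monom g 1) ` G"
  have F': "subring_set F'"
    unfolding subring_set_def F'_def
    using subring_set_1[OF F(1)] subring_set_diff[OF F(1)] subring_set_mult[OF F(1)]
    by (auto simp: one_pCons)
  have "\<exists>b\<in>F'. b * a = 1" if "a \<in> F'" "a \<noteq> 0" for a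
  proof -
    obtain s where s: "a = [:s:]" "s \<in> F" "s \<noteq> 0" using \<open>a \<in> F'\<close> \<open>a \<noteq> 0\<close> by (auto simp: F'_def)
    then obtain t where "t \<in> F" "t * s = 1" using F(2) by blast
    then show ?thesis using s by (intro bexI[of _ "[:t:]"]) (auto simp: F'_def one_pCons mult.commute)
  qed
  then have noeth: "noetherian_set F'" by (rule noetherian_set_field)
  have "finite X'" unfolding X'_def using X G by simp
  from noetherian_finitely_generated[OF F' noeth this]
  obtain B where B: "subring_set B" "noetherian_set B" "F' \<union> X' \<subseteq> B"
    and least: "\<forall>C. subring_set C \<and> F' \<union> X' \<subseteq> C \<longrightarrow> B \<subseteq> C"
    by (elim exE conjE) (rule that)
  \<comment> \<open>B contains every constant: the s with \<open>[:s:]\<close> in B form a subring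
    containing F and X.\<close>
  have "subring_set {s. [:s:] \<in> B}"
    unfolding subring_set_def
    using subring_set_1[OF B(1)] subring_set_diff[OF B(1), of "[:_:]" "[:_:]"]
      subring_set_mult[OF B(1), of "[:_:]" "[:_:]"]
    by (simp add: one_pCons)
  then have "{s. [:s:] \<in> B} = UNIV"
    by (rule gen) (use B(3) in \<open>auto simp: F'_def X'_def\<close>)
  then have "rees I \<subseteq> B"
    by (intro rees_least[OF B(1) _ I]) (use B(3) in \<open>auto simp: X'_def\<close>)
  moreover have "B \<subseteq> rees I"
  proof -
    have "monom g 1 \<in> rees I" if "g \<in> G" for g
      using that I subset_ideal_gen[of G] subset_ideal_pow_1[of I] by (intro monom_in_rees) auto
    then have "F' \<union> X' \<subseteq> rees I"
      unfolding F'_def X'_def using const_in_rees by auto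
    then show ?thesis using least subring_set_rees by blast
  qed
  ultimately show ?thesis using B(2) by simp
qed

text \<open>The J k assemble to an ideal of the Rees algebra, which finitely many polynomials
  generate. E collects their coefficients, each tagged with its exponent j; level k is then reached
  with multipliers from I^(k-j).\<close>

lemma graded_family_finitely_generated:
  fixes J :: "nat \<Rightarrow> 'a::comm_ring_1 set"
  assumes noeth: "noetherian_set (rees I)"
    and J: "\<And>k. is_ideal (J k)" "\<And>k. J k \<subseteq> ideal_pow I k"
    and mult: "\<forall>i k. \<forall>x\<in>ideal_pow I i. \<forall>y\<in>J k. x * y \<in> J (i + k)"
  shows "\<exists>E. finite E \<and> (\<forall>(j, n)\<in>E. n \<in> J j) \<and>
    (\<forall>k. J k \<subseteq> ideal_gen {x * n | x j n. (j, n) \<in> E \<and> j \<le> k \<and> x \<in> ideal_pow I (k - j)})"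
proof -
  define JJ where "JJ = {p. \<forall>k. coeff p k \<in> J k}"
  have coeff_in: "coeff p i * coeff q (k - i) \<in> J k"
    if "p \<in> rees I" "q \<in> JJ" "i \<le> k" for p q i k
    using mult[rule_format, of "coeff p i" i "coeff q (k - i)" "k - i"] that by (simp add: rees_def JJ_def)
  have "submodule_of (rees I) JJ"
    unfolding submodule_of_def
  proof (intro conjI ballI)
    fix p q assume "p \<in> rees I" "q \<in> JJ"
    then show "p * q \<in> JJ"
      using coeff_in[of p q] unfolding JJ_def mem_Collect_eq coeff_mult
      by (intro allI is_ideal_sum[OF J(1)]) simp
  qed (auto simp: JJ_def is_ideal_0[OF J(1)] is_ideal_add[OF J(1)])
  moreover have "JJ \<subseteq> rees I" using J(2) by (auto simp: JJ_def rees_def)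
  ultimately obtain G where G: "finite G" "G \<subseteq> JJ"
    "\<And>J'. submodule_of (rees I) J' \<Longrightarrow> G \<subseteq> J' \<Longrightarrow> JJ \<subseteq> J'"
    using noetherian_setE[OF noeth] by metis
  define E where "E = (\<Union>p\<in>G. (\<lambda>j. (j, coeff p j)) ` {..degree p})"
  define H where "H k = {x * n | x j n. (j, n) \<in> E \<and> j \<le> k \<and> x \<in> ideal_pow I (k - j)}" for k
  \<comment> \<open>The candidate ideal spanned by E. As a submodule containing G it contains the
    whole assembled ideal, in particular y t^k for y in J k, whose coefficient is then read
    off.\<close>
  define J' where "J' = {p. \<forall>k. coeff p k \<in> ideal_gen (H k)}"
  have mult': "x * y \<in> ideal_gen (H (i + k))"
    if "x \<in> ideal_pow I i" "y \<in> ideal_gen (H k)" for x y i k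
  proof (rule ideal_gen_mult[of x "{x}" y "H k"])
    show "x \<in> ideal_gen {x}" by (rule ideal_gen_base) simp
    fix x' z assume x': "x' \<in> {x}" and "z \<in> H k"
    then obtain w j n where w: "z = w * n" "(j, n) \<in> E" "j \<le> k" "w \<in> ideal_pow I (k - j)"
      unfolding H_def by blast
    have "x * w \<in> ideal_pow I (i + k - j)" using ideal_pow_mult[OF that(1) w(4)] w(3) by simp
    then have "(x * w) * n \<in> H (i + k)" unfolding H_def using w(2,3) trans_le_add2 by blast
    then show "x' * z \<in> ideal_gen (H (i + k))"
      using x' w(1) ideal_gen_base[of _ "H (i + k)"] by (simp add: mult.assoc)
  qed (use that is_ideal_ideal_gen in auto)
  have "submodule_of (rees I) J'"
    unfolding submodule_of_def
  proof (intro conjI ballI)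
    fix p q assume pq: "p \<in> rees I" "q \<in> J'"
    have "coeff p i * coeff q (k - i) \<in> ideal_gen (H k)" if "i \<le> k" for i k
      using mult'[of "coeff p i" i "coeff q (k - i)" "k - i"] that pq
      by (simp add: rees_def J'_def)
    then show "p * q \<in> J'"
      unfolding J'_def mem_Collect_eq coeff_mult
      by (intro allI is_ideal_sum[OF is_ideal_ideal_gen]) simp
  qed (auto simp: J'_def is_ideal_0[OF is_ideal_ideal_gen] is_ideal_add[OF is_ideal_ideal_gen])
  moreover have "G \<subseteq> J'"
  proof
    fix p assume p: "p \<in> G"
    have "coeff p k \<in> ideal_gen (H k)" for k
    proof (cases "k \<le> degree p")
      case True
      then have "(k, coeff p k) \<in> E" using p by (auto simp: E_def)
      moreover have "1 \<in> ideal_pow I (k - k)" by (simp add: ideal_pow_0)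
      ultimately have "1 * coeff p k \<in> H k" unfolding H_def by blast
      then show ?thesis using ideal_gen_base[of _ "H k"] by simp
    next
      case False
      then show ?thesis by (simp add: coeff_eq_0 is_ideal_0[OF is_ideal_ideal_gen])
    qed
    then show "p \<in> J'" by (simp add: J'_def)
  qed
  ultimately have "JJ \<subseteq> J'" by (rule G(3))
  have "J k \<subseteq> ideal_gen (H k)" for k
  proof
    fix y assume "y \<in> J k"
    then have "monom y k \<in> JJ" by (auto simp: JJ_def is_ideal_0[OF J(1)])
    then have "monom y k \<in> J'" using \<open>JJ \<subseteq> J'\<close> by blast
    then have "coeff (monom y k) k \<in> ideal_gen (H k)" unfolding J'_def by blast
    then show "y \<in> ideal_gen (H k)" by simp
  qed
  moreover have "finite E" unfolding E_def using G(1) by auto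
  moreover have "\<forall>(j, n)\<in>E. n \<in> J j" using G(2) by (auto simp: E_def JJ_def)
  ultimately show ?thesis unfolding H_def by blast
qed

section \<open>Eventually linear minima\<close>

text \<open>The empty outcome is separate because \<open>LEAST\<close> over an empty set is an
  unspecified number, which must not enter the minimum of a union.\<close>

definition eventually_linear_min :: "(nat \<Rightarrow> nat set) \<Rightarrow> bool" where
  "eventually_linear_min W \<longleftrightarrow> (\<exists>k0. \<forall>k\<ge>k0. W k = {}) \<or>
     (\<exists>a b :: int. \<exists>k0. \<forall>k\<ge>k0. W k \<noteq> {} \<and> int (LEAST d. d \<in> W k) = a * int k + b)"

lemma eventually_linear_minD:
  assumes "eventually_linear_min W"
  shows "\<exists>a b :: int. \<exists>k0. \<forall>k\<ge>k0. int (LEAST d. d \<in> W k) = a * int k + b"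
proof (cases "\<exists>k0. \<forall>k\<ge>k0. W k = {}")
  case True
  then obtain k0 where "\<forall>k\<ge>k0. W k = {}" by blast
  \<comment> \<open>Whatever number \<open>LEAST\<close> yields for the empty set, it is the same
    for every k, so slope 0 fits.\<close>
  then have "\<forall>k\<ge>k0. int (LEAST d. d \<in> W k) = 0 * int k + int (LEAST d. d \<in> ({} :: nat set))"
    by simp
  then show ?thesis by blast
next
  case False
  then show ?thesis using assms unfolding eventually_linear_min_def by blast
qed

lemma eventually_linear_min_cong:
  assumes "eventually_linear_min W" "\<And>k. k \<ge> k0 \<Longrightarrow> V k = W k"
  shows "eventually_linear_min V"
proof -
  from assms(1) consider k1 where "\<forall>k\<ge>k1. W k = {}"
    | a b :: int and k1 where "\<forall>k\<ge>k1. W k \<noteq> {} \<and> int (LEAST d. d \<in> W k) = a * int k + b"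
    unfolding eventually_linear_min_def by blast
  then show ?thesis
  proof cases
    case 1
    then have "\<forall>k\<ge>max k0 k1. V k = {}" using assms(2) by simp
    then show ?thesis unfolding eventually_linear_min_def by blast
  next
    case 2
    then have "\<forall>k\<ge>max k0 k1. V k \<noteq> {} \<and> int (LEAST d. d \<in> V k) = a * int k + b"
      using assms(2) by simp
    then show ?thesis unfolding eventually_linear_min_def by blast
  qed
qed

lemma eventually_linear_min_shift:
  assumes "eventually_linear_min (\<lambda>k. W (k + c))"
  shows "eventually_linear_min W"
proof -
  from assms consider k1 where "\<forall>k\<ge>k1. W (k + c) = {}"
    | a b :: int and k1 where "\<forall>k\<ge>k1. W (k + c) \<noteq> {} \<and> int (LEAST d. d \<in> W (k + c)) = a * int k + b"
    unfolding eventually_linear_min_def by blast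
  then show ?thesis
  proof cases
    case 1
    then have "\<forall>k\<ge>k1 + c. W k = {}" by (metis add_le_imp_le_diff le_add_diff_inverse2 le_add2 le_trans)
    then show ?thesis unfolding eventually_linear_min_def by blast
  next
    case 2
    have "W k \<noteq> {} \<and> int (LEAST d. d \<in> W k) = a * int k + (b - a * int c)" if "k \<ge> k1 + c" for k
      using 2[rule_format, of "k - c"] that by (simp add: of_nat_diff algebra_simps)
    then show ?thesis unfolding eventually_linear_min_def by blast
  qed
qed

lemma Least_Un_nat:
  fixes A B :: "nat set"
  assumes "A \<noteq> {}" "B \<noteq> {}"
  shows "(LEAST d. d \<in> A \<union> B) = min (LEAST d. d \<in> A) (LEAST d. d \<in> B)"
proof (rule Least_equality)
  have "(LEAST d. d \<in> A) \<in> A" "(LEAST d. d \<in> B) \<in> B"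
    using assms by (auto intro: LeastI)
  then show "min (LEAST d. d \<in> A) (LEAST d. d \<in> B) \<in> A \<union> B" by (simp add: min_def)
  fix d assume "d \<in> A \<union> B"
  then show "min (LEAST d. d \<in> A) (LEAST d. d \<in> B) \<le> d"
    by (auto intro: Least_le min.coboundedI1 min.coboundedI2)
qed

lemma eventually_min_linear:
  fixes a b a' b' :: int
  shows "\<exists>c e k0. \<forall>k\<ge>k0::nat. min (a * int k + b) (a' * int k + b') = c * int k + e"
proof -
  \<comment> \<open>A slope gap of at least 1 outweighs the difference of the intercepts once k
    reaches its absolute value.\<close>
  have *: "\<forall>k\<ge>nat \<bar>q - s\<bar>. min (p * int k + q) (r * int k + s) = p * int k + q"
    if "p < r" for p q r s :: int
  proof (intro allI impI)
    fix k assume "k \<ge> nat \<bar>q - s\<bar>"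
    then have "q - s \<le> int k" by linarith
    also have "\<dots> \<le> (r - p) * int k" using that mult_right_mono[of 1 "r - p" "int k"] by simp
    finally show "min (p * int k + q) (r * int k + s) = p * int k + q" by (simp add: algebra_simps)
  qed
  consider "a < a'" | "a' < a" | "a = a'" by linarith
  then show ?thesis
  proof cases
    case 1
    then show ?thesis using *[of a a' b b'] by blast
  next
    case 2
    then show ?thesis using *[of a' a b' b] by (subst min.commute) blast
  next
    case 3
    then show ?thesis by (intro exI[of _ a] exI[of _ "min b b'"]) auto
  qed
qed

lemma eventually_linear_min_Un:
  assumes "eventually_linear_min V" "eventually_linear_min W"
  shows "eventually_linear_min (\<lambda>k. V k \<union> W k)"
proof -
  have empty: "eventually_linear_min (\<lambda>k. V k \<union> W k)"
    if "\<forall>k\<ge>k0. V k = {}" "eventually_linear_min W" for k0 and V W :: "nat \<Rightarrow> nat set"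
    by (rule eventually_linear_min_cong[OF that(2), of k0]) (use that(1) in auto)
  consider k0 where "\<forall>k\<ge>k0. V k = {}" | k0 where "\<forall>k\<ge>k0. W k = {}"
    | a b a' b' :: int and k0 k1 where "\<forall>k\<ge>k0. V k \<noteq> {} \<and> int (LEAST d. d \<in> V k) = a * int k + b"
      "\<forall>k\<ge>k1. W k \<noteq> {} \<and> int (LEAST d. d \<in> W k) = a' * int k + b'"
    using assms unfolding eventually_linear_min_def by blast
  then show ?thesis
  proof cases
    case 1
    then show ?thesis using empty assms(2) by blast
  next
    case 2
    then show ?thesis using empty[of k0 W V] assms(1) by (simp add: Un_commute)
  next
    case 3
    obtain c e k2 where k2: "\<forall>k\<ge>k2. min (a * int k + b) (a' * int k + b') = c * int k + e"
      using eventually_min_linear by blast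
    have "V k \<union> W k \<noteq> {} \<and> int (LEAST d. d \<in> V k \<union> W k) = c * int k + e"
      if "k \<ge> max k0 (max k1 k2)" for k
      using that 3 k2 by (simp add: Least_Un_nat of_nat_min del: Un_iff)
    then show ?thesis unfolding eventually_linear_min_def by blast
  qed
qed

lemma eventually_linear_min_UN:
  assumes "finite F" "\<And>P. P \<in> F \<Longrightarrow> eventually_linear_min (W P)"
  shows "eventually_linear_min (\<lambda>k. \<Union>P\<in>F. W P k)"
  using assms
proof (induction F rule: finite_induct)
  case empty
  then show ?case by (simp add: eventually_linear_min_def)
next
  case (insert P F)
  then show ?case using eventually_linear_min_Un[of "W P" "\<lambda>k. \<Union>P\<in>F. W P k"] by simp
qed

lemma Least_eq_cofinal:
  fixes A B :: "nat set"
  assumes "A \<subseteq> B" "\<And>d. d \<in> B \<Longrightarrow> \<exists>d'\<in>A. d' \<le> d"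
  shows "(LEAST d. d \<in> A) = (LEAST d. d \<in> B)"
proof (cases "B = {}")
  case False
  then have B: "(LEAST d. d \<in> B) \<in> B" by (auto intro: LeastI)
  then obtain d' where d': "d' \<in> A" "d' \<le> (LEAST d. d \<in> B)" using assms(2) by blast
  have "(LEAST d. d \<in> A) \<le> d'" using d'(1) by (rule Least_le)
  moreover have "(LEAST d. d \<in> A) \<in> A" using d'(1) by (rule LeastI)
  then have "(LEAST d. d \<in> B) \<le> (LEAST d. d \<in> A)" using assms(1) by (intro Least_le) blast
  ultimately show ?thesis using d'(2) by linarith
qed (use assms(1) in auto)

text \<open>Lets the degrees of surviving generator products stand in for the degrees of all
  homogeneous witnesses.\<close>

lemma eventually_linear_min_cofinal:
  assumes "eventually_linear_min W" "\<And>k. W k \<subseteq> V k" "\<And>k d. d \<in> V k \<Longrightarrow> \<exists>d'\<in>W k. d' \<le> d"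
  shows "eventually_linear_min V"
proof -
  have "(LEAST d. d \<in> W k) = (LEAST d. d \<in> V k)" "W k = {} \<longleftrightarrow> V k = {}" for k
    using Least_eq_cofinal[OF assms(2,3)] assms(2,3) by blast+
  then show ?thesis using assms(1) unfolding eventually_linear_min_def by simp
qed

section \<open>Counting in down-closed families of multisets\<close>

lemma size_mset_le_card:
  assumes "finite G" "set_mset A \<subseteq> G" "\<And>g. g \<in> G \<Longrightarrow> count A g \<le> C"
  shows "size A \<le> C * card G"
proof -
  have "size A = (\<Sum>g\<in>set_mset A. count A g)" by (simp add: size_multiset_overloaded_eq)
  also have "\<dots> \<le> (\<Sum>g\<in>G. count A g)" using assms(1,2) by (intro sum_mono2) auto
  also have "\<dots> \<le> (\<Sum>g\<in>G. C)" using assms(3) by (intro sum_mono)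
  finally show ?thesis by (simp add: mult.commute)
qed

text \<open>The gap to the bound is a nonincreasing natural number; from the place where it is
  least, monotonicity leaves no room for change.\<close>

lemma mono_bounded_int_eventually_const:
  fixes f :: "nat \<Rightarrow> int"
  assumes mono: "\<And>k. k \<ge> k0 \<Longrightarrow> f k \<le> f (Suc k)" and bound: "\<And>k. k \<ge> k0 \<Longrightarrow> f k \<le> B"
  shows "\<exists>c k1. \<forall>k\<ge>k1. f k = c"
proof -
  define g where "g k = nat (B - f k)" for k
  define m where "m = (LEAST m. m \<in> g ` {k0..})"
  have "g k0 \<in> g ` {k0..}" by simp
  then have "m \<in> g ` {k0..}" unfolding m_def by (rule LeastI)
  then obtain k1 where k1: "k1 \<ge> k0" "g k1 = m" by auto
  have min: "m \<le> g k" if "k \<ge> k0" for k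
    unfolding m_def by (rule Least_le) (use that in simp)
  have "f k = f k1" if "k \<ge> k1" for k
  proof -
    have "f k1 \<le> f k" using that
      by (induction rule: dec_induct) (use mono k1(1) le_trans order_trans in \<open>blast+\<close>)
    moreover have "g k1 \<le> g k" using min[of k] k1 that by simp
    ultimately show ?thesis using bound[of k] bound[of k1] k1(1) that by (simp add: g_def)
  qed
  then show ?thesis by blast
qed

text \<open>Let \<open>a\<close> be the smallest degree of a generator of which arbitrarily high powers occur in \<open>W\<close>.
  The generators of smaller degree occur boundedly often, so a large multiset contains one of degree
  at least \<open>a\<close>; removing it shows that (minimal degree) \<open>- a k\<close> is eventually nondecreasing in \<open>k\<close>,
  and the powers of the generator of degree \<open>a\<close> bound it from above.\<close>

lemma eventually_linear_min_downclosed: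
  fixes W :: "('g multiset \<times> 'e) set" and deg :: "'g \<Rightarrow> nat" and lev edeg :: "'e \<Rightarrow> nat"
  assumes G: "finite G" and E: "finite E"
    and W: "\<And>A e. (A, e) \<in> W \<Longrightarrow> set_mset A \<subseteq> G \<and> e \<in> E"
    and down: "\<And>A B e. (A, e) \<in> W \<Longrightarrow> B \<subseteq># A \<Longrightarrow> (B, e) \<in> W"
  shows "eventually_linear_min
    (\<lambda>k. {sum_mset (image_mset deg A) + edeg e | A e. (A, e) \<in> W \<and> size A + lev e = k})"
    (is "eventually_linear_min ?D")
proof -
  \<comment> \<open>Unboundedness is taken per label e. By down-closure, a power of g missing with
    label e bounds the multiplicity of g in every multiset carrying e.\<close>
  define unb where "unb g e \<longleftrightarrow> (\<forall>r. (replicate_mset r g, e) \<in> W)" for g e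
  have "\<exists>C. \<forall>A. (A, e) \<in> W \<longrightarrow> count A g \<le> C" if nu: "\<not> unb g e" for g e
  proof -
    obtain r where r: "(replicate_mset r g, e) \<notin> W" using nu unfolding unb_def by blast
    have "count A g \<le> r" if "(A, e) \<in> W" for A
    proof (rule ccontr)
      assume "\<not> count A g \<le> r"
      then have "replicate_mset r g \<subseteq># A" by (simp add: count_le_replicate_mset_subset_eq[symmetric])
      then show False using down[OF that] r by blast
    qed
    then show ?thesis by blast
  qed
  then obtain c where c: "\<And>g e A. \<not> unb g e \<Longrightarrow> (A, e) \<in> W \<Longrightarrow> count A g \<le> c g e" by metis
  define C where "C = (\<Sum>(g, e)\<in>G \<times> E. c g e)"
  have c_le: "c g e \<le> C" if "g \<in> G" "e \<in> E" for g e
    unfolding C_def using G E that member_le_sum[of "(g, e)" "G \<times> E" "\<lambda>(g, e). c g e"] by auto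
  define L where "L = (\<Sum>e\<in>E. lev e)"
  have L: "lev e \<le> L" if "e \<in> E" for e
    unfolding L_def using E that member_le_sum[of e E lev] by auto
  \<comment> \<open>If each generator occurs at most C times, size plus level cannot exceed this
    number.\<close>
  define k0 where "k0 = C * card G + L"
  show ?thesis
  proof (cases "\<exists>g\<in>G. \<exists>e\<in>E. unb g e")
    case False
    have "size A + lev e \<le> k0" if "(A, e) \<in> W" for A e
    proof -
      have e: "e \<in> E" and A: "set_mset A \<subseteq> G" using W[OF that] by auto
      have "size A \<le> C * card G"
        by (rule size_mset_le_card[OF G A]) (use False c c_le e that le_trans in blast)
      then show ?thesis using L[OF e] by (simp add: k0_def)
    qed
    then have "\<forall>k\<ge>Suc k0. ?D k = {}" by fastforce
    then show ?thesis unfolding eventually_linear_min_def by blast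
  next
    case True
    define S where "S = {deg g | g e. g \<in> G \<and> e \<in> E \<and> unb g e}"
    define a where "a = (LEAST d. d \<in> S)"
    have "\<exists>d. d \<in> S" using True unfolding S_def by blast
    then have "a \<in> S" unfolding a_def by (rule LeastI_ex)
    then obtain g e where ge: "a = deg g" "g \<in> G" "e \<in> E" "unb g e" unfolding S_def by blast
    have small: "\<not> unb h e'" if "h \<in> G" "e' \<in> E" "deg h < a" for h e'
    proof
      assume "unb h e'"
      then have "deg h \<in> S" unfolding S_def using that by blast
      then have "a \<le> deg h" unfolding a_def by (rule Least_le)
      then show False using that(3) by simp
    qed
    have top: "edeg e + a * (k - lev e) \<in> ?D k" if "k \<ge> k0" for k
    proof -
      have "lev e \<le> k" using L[OF ge(3)] that by (simp add: k0_def)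
      moreover have "(replicate_mset (k - lev e) g, e) \<in> W" using ge(4) by (simp add: unb_def)
      ultimately show ?thesis using ge(1)
        by (intro CollectI exI[of _ "replicate_mset (k - lev e) g"] exI[of _ e]) auto
    qed
    \<comment> \<open>From level Suc k with k at least k0, the size of A exceeds C * card G, so A
      contains a generator of degree at least a; dropping it lowers the level by exactly 1.\<close>
    have step: "\<exists>d'\<in>?D k. d' + a \<le> d" if d: "d \<in> ?D (Suc k)" and k: "k \<ge> k0" for d k
    proof -
      obtain A e' where A: "d = sum_mset (image_mset deg A) + edeg e'" "(A, e') \<in> W"
        "size A + lev e' = Suc k" using d by blast
      have e': "e' \<in> E" and AG: "set_mset A \<subseteq> G" using W[OF A(2)] by auto
      have "\<exists>h. h \<in># A \<and> a \<le> deg h"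
      proof (rule ccontr)
        assume "\<not> ?thesis"
        then have lt: "deg h < a" if "h \<in># A" for h using that by force
        have "count A h \<le> C" if "h \<in> G" for h
        proof (cases "h \<in># A")
          case True
          then show ?thesis using c[OF small[OF that e' lt[OF True]] A(2)] c_le[OF that e'] by simp
        qed (simp add: not_in_iff)
        then have "size A \<le> C * card G" by (rule size_mset_le_card[OF G AG])
        then show False using A(3) L[OF e'] k by (simp add: k0_def)
      qed
      then obtain h where h: "h \<in># A" "a \<le> deg h" by blast
      then obtain B where B: "A = add_mset h B" by (meson multi_member_split)
      have "(B, e') \<in> W" using down[OF A(2), of B] B by simp
      moreover have "size B + lev e' = k" using A(3) B by simp
      ultimately have "sum_mset (image_mset deg B) + edeg e' \<in> ?D k" by blast
      then show ?thesis using A(1) B h(2) by (intro bexI) auto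
    qed
    define m where "m k = (LEAST d. d \<in> ?D k)" for k
    have mD: "m k \<in> ?D k" if "k \<ge> k0" for k
      unfolding m_def by (rule LeastI[of "\<lambda>d. d \<in> ?D k", OF top[OF that]])
    have m_le: "m k \<le> d" if "d \<in> ?D k" for d k
      unfolding m_def using that by (rule Least_le)
    have "\<exists>c k1. \<forall>k\<ge>k1. int (m k) - int a * int k = c"
    proof (rule mono_bounded_int_eventually_const)
      fix k assume k: "k \<ge> k0"
      obtain d' where "d' \<in> ?D k" "d' + a \<le> m (Suc k)" using step[OF mD k] k by auto
      then have "m k + a \<le> m (Suc k)" using m_le[of d' k] by linarith
      then show "int (m k) - int a * int k \<le> int (m (Suc k)) - int a * int (Suc k)"
        by (simp add: algebra_simps)
    next
      fix k assume k: "k \<ge> k0"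
      have "m k \<le> edeg e + a * (k - lev e)" using m_le[OF top[OF k]] .
      also have "\<dots> \<le> edeg e + a * k" by simp
      finally have "int (m k) \<le> int (edeg e + a * k)" by (simp only: of_nat_le_iff)
      then show "int (m k) - int a * int k \<le> int (edeg e)" by simp
    qed
    then obtain b k1 where k1: "\<And>k. k \<ge> k1 \<Longrightarrow> int (m k) - int a * int k = b" by blast
    have "?D k \<noteq> {} \<and> int (LEAST d. d \<in> ?D k) = int a * int k + b" if "k \<ge> max k0 k1" for k
    proof -
      have "?D k \<noteq> {}" using mD[of k] that by auto
      moreover have "int (m k) = int a * int k + b" using k1[of k] that by simp
      ultimately show ?thesis unfolding m_def by simp
    qed
    then show ?thesis unfolding eventually_linear_min_def by blast
  qed
qed

section \<open>Homogeneous ideals of the polynomial ring\<close>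

lemma poly_mapping_sum_single:
  "f = (\<Sum>m\<in>Poly_Mapping.keys f. Poly_Mapping.single m (Poly_Mapping.lookup f m))"
proof (rule poly_mapping_eqI)
  fix k
  show "Poly_Mapping.lookup f k = Poly_Mapping.lookup
      (\<Sum>m\<in>Poly_Mapping.keys f. Poly_Mapping.single m (Poly_Mapping.lookup f m)) k"
    by (simp add: lookup_sum lookup_single when_def in_keys_iff)
qed

lemma mpoly_constants_field:
  defines "F \<equiv> range (Poly_Mapping.single 0) :: ('v, 'k::field) mpoly set"
  shows "subring_set F" "\<And>a. a \<in> F \<Longrightarrow> a \<noteq> 0 \<Longrightarrow> \<exists>b\<in>F. b * a = 1"
proof -
  show "subring_set F"
    unfolding subring_set_def
  proof (intro conjI ballI)
    show "1 \<in> F" unfolding F_def by (metis single_one rangeI)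
  next
    fix a b assume "a \<in> F" "b \<in> F"
    then obtain c d where "a = Poly_Mapping.single 0 c" "b = Poly_Mapping.single 0 d"
      unfolding F_def by blast
    then have "a - b = Poly_Mapping.single 0 (c - d)" "a * b = Poly_Mapping.single 0 (c * d)"
      by (simp_all add: single_diff mult_single)
    then show "a - b \<in> F" "a * b \<in> F" unfolding F_def by blast+
  qed
next
  fix a assume "a \<in> F" "a \<noteq> 0"
  then obtain c where c: "a = Poly_Mapping.single 0 c" unfolding F_def by blast
  with \<open>a \<noteq> 0\<close> have "c \<noteq> 0" by auto
  then have "Poly_Mapping.single 0 (inverse c) * a = 1" by (simp add: c mult_single)
  then show "\<exists>b\<in>F. b * a = 1" unfolding F_def by blast
qed

lemma mpoly_generated:
  fixes B :: "('v, 'k::field) mpoly set"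
  assumes B: "subring_set B" and const: "range (Poly_Mapping.single 0) \<subseteq> B"
    and var: "range (\<lambda>v. Poly_Mapping.single (Poly_Mapping.single v 1) 1) \<subseteq> B"
  shows "B = UNIV"
proof -
  \<comment> \<open>The exponents whose monomial lies in B are closed under addition because B is
    closed under products.\<close>
  define T where "T = {m :: 'v \<Rightarrow>\<^sub>0 nat. Poly_Mapping.single m (1::'k) \<in> B}"
  have T_add: "m + n \<in> T" if "m \<in> T" "n \<in> T" for m n
    using subring_set_mult[OF B, of "Poly_Mapping.single m 1" "Poly_Mapping.single n 1"] that
    by (simp add: T_def mult_single)
  have T_0: "0 \<in> T" using subring_set_1[OF B] by (simp add: T_def)
  have T_single: "Poly_Mapping.single v n \<in> T" for v n
  proof (induction n)
    case (Suc n)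
    have "Poly_Mapping.single v 1 \<in> T" using var by (auto simp: T_def)
    then show ?case using T_add[OF _ Suc, of "Poly_Mapping.single v 1"]
      by (simp flip: single_add)
  qed (simp add: T_0)
  have T_sum: "(\<Sum>v\<in>V. Poly_Mapping.single v (n v)) \<in> T" if "finite V" for V and n :: "'v \<Rightarrow> nat"
    using that by (induction V rule: finite_induct) (auto intro: T_0 T_add T_single)
  have T: "m \<in> T" for m
    using T_sum[OF finite_keys[of m], of "Poly_Mapping.lookup m"] by (simp flip: poly_mapping_sum_single)
  have "Poly_Mapping.single m c \<in> B" for m c
    using subring_set_mult[OF B, of "Poly_Mapping.single 0 c" "Poly_Mapping.single m 1"] const T[of m]
    by (auto simp: T_def mult_single)
  then have "(\<Sum>m\<in>Poly_Mapping.keys f. Poly_Mapping.single m (Poly_Mapping.lookup f m)) \<in> B" for f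
    by (intro subring_set_sum[OF B])
  then have "f \<in> B" for f by (simp flip: poly_mapping_sum_single)
  then show ?thesis by blast
qed

lemma noetherian_mpoly: "noetherian_set (UNIV :: ('v::finite, 'k::field) mpoly set)"
proof (rule noetherian_UNIV_if_generated)
  fix B :: "('v, 'k) mpoly set"
  assume "subring_set B" "range (Poly_Mapping.single 0) \<union>
    range (\<lambda>v. Poly_Mapping.single (Poly_Mapping.single v 1) 1) \<subseteq> B"
  then show "B = UNIV" by (intro mpoly_generated) auto
qed (use mpoly_constants_field in auto)

lemma noetherian_rees_mpoly:
  fixes I :: "('v::finite, 'k::field) mpoly set"
  assumes "I = ideal_gen G" "finite G"
  shows "noetherian_set (rees I)"
proof (rule noetherian_rees[OF _ _ _ _ assms])
  fix B :: "('v, 'k) mpoly set"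
  assume "subring_set B" "range (Poly_Mapping.single 0) \<union>
    range (\<lambda>v. Poly_Mapping.single (Poly_Mapping.single v 1) 1) \<subseteq> B"
  then show "B = UNIV" by (intro mpoly_generated) auto
qed (use mpoly_constants_field in auto)

text \<open>The library's integral domain instance needs linearly ordered variables, so the
  variables are numbered.\<close>

lemma mpoly_no_zero_divisors:
  fixes f g :: "('v::finite, 'k::field) mpoly"
  assumes "f * g = 0"
  shows "f = 0 \<or> g = 0"
proof -
  obtain idx :: "'v \<Rightarrow> nat" where idx: "inj idx"
    using finite_imp_inj_to_nat_seg[of "UNIV :: 'v set"] by auto
  define \<phi> where "\<phi> m = (\<Sum>v\<in>UNIV. Poly_Mapping.single (idx v) (Poly_Mapping.lookup m v))"
    for m :: "'v \<Rightarrow>\<^sub>0 nat"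
  have \<phi>_add: "\<phi> (m + n) = \<phi> m + \<phi> n" for m n
    by (simp add: \<phi>_def lookup_add single_add sum.distrib)
  have "Poly_Mapping.lookup (\<phi> m) (idx v) = Poly_Mapping.lookup m v" for m v
    using idx by (simp add: \<phi>_def lookup_sum lookup_single when_def inj_eq)
  then have \<phi>_inj: "\<phi> m = \<phi> n \<longleftrightarrow> m = n" for m n
    by (metis poly_mapping_eqI)
  \<comment> \<open>The ring map induced by the renumbering; it is injective because \<phi> keeps
    distinct exponents apart, so zero products can be tested in the target.\<close>
  define \<Phi> where "\<Phi> f = (\<Sum>m\<in>Poly_Mapping.keys f. Poly_Mapping.single (\<phi> m) (Poly_Mapping.lookup f m))"
    for f :: "('v, 'k) mpoly"
  have \<Phi>_single: "\<Phi> (Poly_Mapping.single m c) = Poly_Mapping.single (\<phi> m) c" for m c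
    by (simp add: \<Phi>_def)
  have \<Phi>_add: "\<Phi> (f + g) = \<Phi> f + \<Phi> g" for f g
    unfolding \<Phi>_def by (rule setsum_keys_plus_distrib) (simp_all add: single_add)
  have "\<Phi> 0 = 0" by (simp add: \<Phi>_def)
  then have \<Phi>_sum: "\<Phi> (sum h T) = (\<Sum>i\<in>T. \<Phi> (h i))" for h and T :: "'i set"
    by (induction T rule: infinite_finite_induct) (simp_all add: \<Phi>_add)
  have \<Phi>_mult: "\<Phi> (f * g) = \<Phi> f * \<Phi> g" for f g
  proof -
    have "f * g = (\<Sum>m\<in>Poly_Mapping.keys f. \<Sum>n\<in>Poly_Mapping.keys g.
        Poly_Mapping.single (m + n) (Poly_Mapping.lookup f m * Poly_Mapping.lookup g n))"
      by (subst poly_mapping_sum_single[of f], subst poly_mapping_sum_single[of g])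
        (simp add: sum_product mult_single)
    then have "\<Phi> (f * g) = (\<Sum>m\<in>Poly_Mapping.keys f. \<Sum>n\<in>Poly_Mapping.keys g.
        Poly_Mapping.single (\<phi> m + \<phi> n) (Poly_Mapping.lookup f m * Poly_Mapping.lookup g n))"
      by (simp add: \<Phi>_sum \<Phi>_single \<phi>_add)
    also have "\<dots> = \<Phi> f * \<Phi> g" by (simp add: \<Phi>_def sum_product mult_single)
    finally show ?thesis .
  qed
  have \<Phi>_0: "f = 0" if "\<Phi> f = 0" for f
  proof (rule poly_mapping_eqI)
    fix m
    have "Poly_Mapping.lookup (\<Phi> f) (\<phi> m) = Poly_Mapping.lookup f m"
      by (simp add: \<Phi>_def lookup_sum lookup_single when_def \<phi>_inj in_keys_iff)
    then show "Poly_Mapping.lookup f m = Poly_Mapping.lookup 0 m" using that by simp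
  qed
  have "\<Phi> f * \<Phi> g = 0" using assms \<Phi>_mult[of f g] by (simp add: \<Phi>_def)
  then show ?thesis using \<Phi>_0 by (metis mult_eq_0_iff)
qed

section \<open>Homogeneous components and homogeneous ideals\<close>

definition hcomp :: "nat \<Rightarrow> ('v, 'k::comm_monoid_add) mpoly \<Rightarrow> ('v, 'k) mpoly" where
  "hcomp d f = (\<Sum>m\<in>{m\<in>Poly_Mapping.keys f. mon_deg m = d}. Poly_Mapping.single m (Poly_Mapping.lookup f m))"

lemma lookup_hcomp:
  "Poly_Mapping.lookup (hcomp d f) m = (if mon_deg m = d then Poly_Mapping.lookup f m else 0)"
  by (auto simp: hcomp_def lookup_sum lookup_single when_def in_keys_iff)

lemma hcomp_homogeneous: "hcomp d f \<in> hom_comp_space d"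
  by (auto simp: hom_comp_space_def in_keys_iff lookup_hcomp split: if_splits)

lemma hom_comp_space_iff: "f \<in> hom_comp_space d \<longleftrightarrow> (\<forall>m. Poly_Mapping.lookup f m \<noteq> 0 \<longrightarrow> mon_deg m = d)"
  by (auto simp: hom_comp_space_def in_keys_iff)

lemma hcomp_of_homogeneous: "f \<in> hom_comp_space e \<Longrightarrow> hcomp d f = (if d = e then f else 0)"
  by (rule poly_mapping_eqI) (auto simp: lookup_hcomp hom_comp_space_iff)

lemma hcomp_add: "hcomp d (f + g) = hcomp d f + hcomp d g"
  by (rule poly_mapping_eqI) (simp add: lookup_hcomp lookup_add)

lemma hcomp_0: "hcomp d 0 = 0"
  by (rule poly_mapping_eqI) (simp add: lookup_hcomp)

lemma hcomp_sum: "hcomp d (sum f T) = (\<Sum>i\<in>T. hcomp d (f i))"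
  by (induction T rule: infinite_finite_induct) (simp_all add: hcomp_0 hcomp_add)

lemma sum_hcomp:
  "f = (\<Sum>d\<in>mon_deg ` Poly_Mapping.keys f. hcomp d f)"
  by (rule poly_mapping_eqI)
    (auto simp: lookup_sum lookup_hcomp in_keys_iff intro: sum.neutral)

lemma hcomp_eq_0: "d \<notin> mon_deg ` Poly_Mapping.keys f \<Longrightarrow> hcomp d f = 0"
  by (intro poly_mapping_eqI) (auto simp: lookup_hcomp in_keys_iff image_iff)

lemma finite_range_hcomp: "finite (range (\<lambda>d. hcomp d f))"
proof (rule finite_subset)
  show "range (\<lambda>d. hcomp d f) \<subseteq> insert 0 ((\<lambda>d. hcomp d f) ` (mon_deg ` Poly_Mapping.keys f))"
  proof (rule image_subsetI)
    fix d
    show "hcomp d f \<in> insert 0 ((\<lambda>d. hcomp d f) ` (mon_deg ` Poly_Mapping.keys f))"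
    proof (cases "d \<in> mon_deg ` Poly_Mapping.keys f")
      case False
      then have "hcomp d f = 0"
        by (rule hcomp_eq_0)
      then show ?thesis by simp
    qed blast
  qed
qed simp

lemma mon_deg_add:
  fixes m n :: "'v::finite \<Rightarrow>\<^sub>0 nat"
  shows "mon_deg (m + n) = mon_deg m + mon_deg n"
proof -
  have "mon_deg m = sum (Poly_Mapping.lookup m) UNIV" for m :: "'v \<Rightarrow>\<^sub>0 nat"
    unfolding mon_deg_def by (rule sum.mono_neutral_left) (auto simp: in_keys_iff)
  then show ?thesis by (simp add: lookup_add sum.distrib)
qed

lemma hom_comp_space_mult:
  fixes f g :: "('v::finite, 'k::field) mpoly"
  assumes "f \<in> hom_comp_space d" "g \<in> hom_comp_space e"
  shows "f * g \<in> hom_comp_space (d + e)"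
proof -
  have "mon_deg m = d + e" if "m \<in> Poly_Mapping.keys (f * g)" for m
  proof -
    from subsetD[OF keys_mult that]
    obtain a b where "m = a + b" "a \<in> Poly_Mapping.keys f" "b \<in> Poly_Mapping.keys g"
      by blast
    then show ?thesis using assms by (auto simp: hom_comp_space_def mon_deg_add)
  qed
  then show ?thesis by (simp add: hom_comp_space_def)
qed

lemma hcomp_mult_homogeneous:
  fixes f g :: "('v::finite, 'k::field) mpoly"
  assumes "g \<in> hom_comp_space e"
  shows "hcomp d (f * g) = (if e \<le> d then hcomp (d - e) f * g else 0)"
proof -
  define T where "T = mon_deg ` Poly_Mapping.keys f"
  have "f * g = (\<Sum>i\<in>T. hcomp i f * g)"
    unfolding T_def using sum_hcomp[of f] by (metis sum_distrib_right)
  then have "hcomp d (f * g) = (\<Sum>i\<in>T. hcomp d (hcomp i f * g))" by (simp add: hcomp_sum)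
  also have "\<dots> = (\<Sum>i\<in>T. if d = i + e then hcomp i f * g else 0)"
    by (intro sum.cong refl hcomp_of_homogeneous hom_comp_space_mult hcomp_homogeneous assms)
  \<comment> \<open>Solves d = i + e for i; the guard is there because subtraction of naturals
    truncates.\<close>
  also have "\<dots> = (\<Sum>i\<in>T. if i = d - e then (if e \<le> d then hcomp (d - e) f * g else 0) else 0)"
    by (intro sum.cong) auto
  also have "\<dots> = (if d - e \<in> T \<and> e \<le> d then hcomp (d - e) f * g else 0)"
    unfolding T_def by simp
  also have "\<dots> = (if e \<le> d then hcomp (d - e) f * g else 0)"
  proof (cases "d - e \<in> T")
    case False
    then have "hcomp (d - e) f = 0"
      by (simp add: T_def hcomp_eq_0)
    then show ?thesis by simp
  qed simp
  finally show ?thesis .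
qed

text \<open>Multipliers can only raise degrees, so a component of degree d sees only generators of
  degree at most d. This turns a homogeneous witness of degree d into a generator product of degree
  at most d.\<close>

lemma hcomp_in_ideal_gen:
  fixes H :: "('v::finite, 'k::field) mpoly set"
  assumes H: "\<And>h. h \<in> H \<Longrightarrow> \<exists>e. h \<in> hom_comp_space e" and f: "f \<in> ideal_gen H"
  shows "hcomp d f \<in> ideal_gen {h \<in> H. \<exists>e\<le>d. h \<in> hom_comp_space e}"
proof -
  define L where "L d = ideal_gen {h \<in> H. \<exists>e\<le>d. h \<in> hom_comp_space e}" for d
  have L: "is_ideal (L d)" for d by (simp add: L_def is_ideal_ideal_gen)
  have mono: "L d \<subseteq> L d'" if "d \<le> d'" for d d'
    unfolding L_def using that order_trans by (intro ideal_gen_mono) blast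
  \<comment> \<open>All components are treated at once: L d grows with d, which makes J closed under
    arbitrary multiples.\<close>
  define J where "J = {f. \<forall>d. hcomp d f \<in> L d}"
  have "is_ideal J"
    unfolding is_ideal_def
  proof (intro conjI ballI allI)
    show "0 \<in> J" by (simp add: J_def hcomp_0 is_ideal_0[OF L])
  next
    fix f g assume "f \<in> J" "g \<in> J"
    then show "f + g \<in> J" by (simp add: J_def hcomp_add is_ideal_add[OF L])
  next
    fix f g assume f: "f \<in> J"
    have "hcomp d (f * hcomp i g) \<in> L d" for d i
    proof (cases "i \<le> d")
      case True
      have "hcomp (d - i) f \<in> L d" using f mono[of "d - i" d] by (auto simp: J_def)
      then show ?thesis
        using True by (simp add: hcomp_mult_homogeneous[OF hcomp_homogeneous] is_ideal_mult_right[OF L])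
    qed (simp add: hcomp_mult_homogeneous[OF hcomp_homogeneous] is_ideal_0[OF L])
    then have "(\<Sum>i\<in>mon_deg ` Poly_Mapping.keys g. hcomp d (f * hcomp i g)) \<in> L d" for d
      by (intro is_ideal_sum[OF L])
    then have "hcomp d (f * (\<Sum>i\<in>mon_deg ` Poly_Mapping.keys g. hcomp i g)) \<in> L d" for d
      by (simp add: hcomp_sum sum_distrib_left)
    then have "hcomp d (f * g) \<in> L d" for d by (simp flip: sum_hcomp)
    then show "g * f \<in> J" by (simp add: J_def mult.commute)
  qed
  moreover have "H \<subseteq> J"
  proof
    fix h assume h: "h \<in> H"
    obtain e where e: "h \<in> hom_comp_space e" using H[OF h] by blast
    have "h \<in> L e" unfolding L_def using h e by (intro ideal_gen_base) auto
    then show "h \<in> J" using hcomp_of_homogeneous[OF e] by (simp add: J_def is_ideal_0[OF L])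
  qed
  ultimately have "f \<in> J" using ideal_gen_least f by blast
  then show ?thesis by (simp add: J_def L_def)
qed

text \<open>Closure under components, in contrast to the generation by homogeneous elements in
  \<open>graded_ideal\<close>, is the form that passes directly to colon ideals.\<close>

definition homogeneous_ideal :: "('v, 'k::field) mpoly set \<Rightarrow> bool" where
  "homogeneous_ideal J \<longleftrightarrow> is_ideal J \<and> (\<forall>f\<in>J. \<forall>d. hcomp d f \<in> J)"

lemma homogeneous_ideal_gen:
  fixes H :: "('v::finite, 'k::field) mpoly set"
  assumes "\<And>h. h \<in> H \<Longrightarrow> \<exists>e. h \<in> hom_comp_space e"
  shows "homogeneous_ideal (ideal_gen H)"
proof -
  have "hcomp d f \<in> ideal_gen H" if "f \<in> ideal_gen H" for d f
    using hcomp_in_ideal_gen[OF assms that, of d]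
      ideal_gen_mono[of "{h \<in> H. \<exists>e\<le>d. h \<in> hom_comp_space e}" H] by blast
  then show ?thesis by (simp add: homogeneous_ideal_def is_ideal_ideal_gen)
qed

lemma in_ideal_if_hcomp:
  assumes "is_ideal J" "\<And>d. hcomp d f \<in> J"
  shows "f \<in> J"
  using is_ideal_sum[OF assms(1), of "mon_deg ` Poly_Mapping.keys f" "\<lambda>d. hcomp d f"] assms(2)
  by (simp flip: sum_hcomp)

text \<open>Take the components of a finite generating set: each element has finitely many, they
  stay in I, and they sum up to it.\<close>

lemma graded_ideal_generators:
  fixes I :: "('v::finite, 'k::field) mpoly set"
  assumes "graded_ideal I"
  shows "\<exists>G. finite G \<and> (\<forall>g\<in>G. \<exists>e. g \<in> hom_comp_space e) \<and> I = ideal_gen G"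
proof -
  have I: "is_ideal I" "I = ideal_gen (I \<inter> (\<Union>d. hom_comp_space d))"
    using assms by (simp_all only: graded_ideal_def)
  have "homogeneous_ideal (ideal_gen (I \<inter> (\<Union>d. hom_comp_space d)))"
    by (rule homogeneous_ideal_gen) blast
  then have hom: "homogeneous_ideal I" using I(2) by simp
  obtain G0 where G0: "finite G0" "G0 \<subseteq> I" "\<And>J'. submodule_of UNIV J' \<Longrightarrow> G0 \<subseteq> J' \<Longrightarrow> I \<subseteq> J'"
    using noetherian_setE[OF noetherian_mpoly, of I] I(1) unfolding is_ideal_iff_submodule by blast
  define G where "G = (\<Union>f\<in>G0. range (\<lambda>d. hcomp d f))"
  have "finite G" unfolding G_def using G0(1) finite_range_hcomp by blast
  moreover have "\<forall>g\<in>G. \<exists>e. g \<in> hom_comp_space e" unfolding G_def using hcomp_homogeneous by blast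
  moreover have "ideal_gen G \<subseteq> I"
    by (rule ideal_gen_least[OF I(1)]) (use hom G0(2) in \<open>auto simp: G_def homogeneous_ideal_def\<close>)
  moreover have "I \<subseteq> ideal_gen G"
  proof (rule G0(3))
    show "submodule_of UNIV (ideal_gen G)" using is_ideal_ideal_gen by (simp flip: is_ideal_iff_submodule)
    show "G0 \<subseteq> ideal_gen G"
    proof
      fix f assume "f \<in> G0"
      then have "hcomp d f \<in> ideal_gen G" for d by (intro ideal_gen_base) (auto simp: G_def)
      then show "f \<in> ideal_gen G" by (rule in_ideal_if_hcomp[OF is_ideal_ideal_gen])
    qed
  qed
  ultimately show ?thesis by blast
qed

lemma prod_mset_homogeneous:
  fixes A :: "('v::finite, 'k::field) mpoly multiset"
  assumes "\<And>g. g \<in># A \<Longrightarrow> g \<in> hom_comp_space (deg g)"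
  shows "prod_mset A \<in> hom_comp_space (sum_mset (image_mset deg A))"
  using assms
proof (induction A)
  case empty
  then show ?case by (simp add: hom_comp_space_def mon_deg_def)
next
  case (add g A)
  then show ?case using hom_comp_space_mult[of g "deg g" "prod_mset A"] by simp
qed

lemma homogeneous_ideal_pow:
  fixes G :: "('v::finite, 'k::field) mpoly set"
  assumes G: "\<forall>g\<in>G. \<exists>e. g \<in> hom_comp_space e" and I: "I = ideal_gen G"
  shows "homogeneous_ideal (ideal_pow I k)"
  unfolding ideal_pow_generators[OF I]
proof (rule homogeneous_ideal_gen)
  fix h assume "h \<in> {prod_mset A |A. set_mset A \<subseteq> G \<and> size A = k}"
  then obtain A where A: "h = prod_mset A" "set_mset A \<subseteq> G" by blast
  obtain deg where "\<And>g. g \<in> G \<Longrightarrow> g \<in> hom_comp_space (deg g)" using G by metis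
  then show "\<exists>e. h \<in> hom_comp_space e" using A prod_mset_homogeneous[of A deg] by blast
qed

lemma homogeneous_ideal_colon:
  fixes J :: "('v::finite, 'k::field) mpoly set"
  assumes J: "homogeneous_ideal J" and f: "f \<in> hom_comp_space e"
  shows "homogeneous_ideal (colon J f)"
proof -
  have "hcomp d s * f \<in> J" if "s * f \<in> J" for d s
  proof -
    have "hcomp (d + e) (s * f) \<in> J" using J that by (simp add: homogeneous_ideal_def)
    then show ?thesis by (simp add: hcomp_mult_homogeneous[OF f])
  qed
  then show ?thesis using J is_ideal_colon[of J f] by (simp add: homogeneous_ideal_def colon_def)
qed

text \<open>An element p of P is tested through its components, which stay in P: for homogeneous
  factors the components of a product can be read off.\<close>

lemma homogeneous_ideal_colon_set:
  fixes J P :: "('v::finite, 'k::field) mpoly set"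
  assumes J: "homogeneous_ideal J" and P: "homogeneous_ideal P"
  shows "homogeneous_ideal {y. \<forall>p\<in>P. p * y \<in> J}"
proof -
  have iJ: "is_ideal J" using J by (simp add: homogeneous_ideal_def)
  have "p * hcomp d y \<in> J" if y: "\<forall>p\<in>P. p * y \<in> J" and p: "p \<in> P" for y p d
  proof -
    have "hcomp d y * hcomp e p \<in> J" for e
    proof -
      have "hcomp e p \<in> P" using P p by (simp add: homogeneous_ideal_def)
      then have "y * hcomp e p \<in> J" using y by (metis mult.commute)
      then have "hcomp (d + e) (y * hcomp e p) \<in> J" using J by (simp add: homogeneous_ideal_def)
      then show ?thesis by (simp add: hcomp_mult_homogeneous[OF hcomp_homogeneous])
    qed
    then have "(\<Sum>e\<in>mon_deg ` Poly_Mapping.keys p. hcomp d y * hcomp e p) \<in> J"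
      by (intro is_ideal_sum[OF iJ])
    then have "hcomp d y * p \<in> J" by (simp add: sum_distrib_left[symmetric] flip: sum_hcomp)
    then show ?thesis by (simp add: mult.commute)
  qed
  then show ?thesis using is_ideal_colon_set[OF iJ] by (simp add: homogeneous_ideal_def)
qed

section \<open>Asymptotic linearity\<close>

text \<open>The multiples of g in I^k form a graded ideal of the Rees algebra with generators n of
  level j at most c. At level k + c every multiplier lies in I^(k+c-j), hence in I^k, and every n is
  a multiple of g; so the elements there lie in g I^k, and g cancels.\<close>

lemma artin_rees_colon:
  fixes I :: "'a::comm_ring_1 set"
  assumes noeth: "noetherian_set (rees I)" and g: "\<And>x y. x * g = y * g \<Longrightarrow> x = y"
  shows "\<exists>c. \<forall>k. colon (ideal_pow I (k + c)) g \<subseteq> ideal_pow I k"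
proof -
  define J where "J k = {y \<in> ideal_pow I k. g dvd y}" for k
  have J: "is_ideal (J k)" for k
    using is_ideal_pow[of I k] by (auto simp: J_def is_ideal_def)
  have mult: "\<forall>i k. \<forall>x\<in>ideal_pow I i. \<forall>y\<in>J k. x * y \<in> J (i + k)"
    using ideal_pow_mult by (auto simp: J_def)
  have "J k \<subseteq> ideal_pow I k" for k by (auto simp: J_def)
  from graded_family_finitely_generated[OF noeth J this mult]
  obtain E where E: "finite E" "\<forall>(j, n)\<in>E. n \<in> J j"
    and gen: "\<forall>k. J k \<subseteq> ideal_gen {x * n | x j n. (j, n) \<in> E \<and> j \<le> k \<and> x \<in> ideal_pow I (k - j)}"
    by (elim exE conjE) (rule that)
  \<comment> \<open>Any common bound of the levels in E would do; the sum is a convenient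
    one.\<close>
  define c where "c = (\<Sum>e\<in>E. fst e)"
  have c: "j \<le> c" if "(j, n) \<in> E" for j n
    unfolding c_def using member_le_sum[OF that, of fst] E(1) by simp
  have "y \<in> ideal_pow I k" if y: "y * g \<in> ideal_pow I (k + c)" for y k
  proof -
    define L where "L = (\<lambda>z. z * g) ` ideal_pow I k"
    have "is_ideal L"
      unfolding is_ideal_def
    proof (intro conjI ballI allI)
      show "0 \<in> L" unfolding L_def using is_ideal_0[OF is_ideal_pow] by (force intro: rev_image_eqI)
    next
      fix u v assume "u \<in> L" "v \<in> L"
      then obtain z w where zw: "u = z * g" "v = w * g" "z \<in> ideal_pow I k" "w \<in> ideal_pow I k"
        unfolding L_def by blast
      then have "u + v = (z + w) * g" by (simp add: distrib_right)
      then show "u + v \<in> L" unfolding L_def using is_ideal_add[OF is_ideal_pow zw(3,4)] by blast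
    next
      fix u a assume "u \<in> L"
      then obtain z where z: "u = z * g" "z \<in> ideal_pow I k" unfolding L_def by blast
      then have "a * u = (a * z) * g" by (simp add: mult.assoc)
      then show "a * u \<in> L" unfolding L_def using is_ideal_mult_left[OF is_ideal_pow z(2)] by blast
    qed
    moreover have "{x * n | x j n. (j, n) \<in> E \<and> j \<le> k + c \<and> x \<in> ideal_pow I (k + c - j)} \<subseteq> L"
    proof
      fix u assume "u \<in> {x * n | x j n. (j, n) \<in> E \<and> j \<le> k + c \<and> x \<in> ideal_pow I (k + c - j)}"
      then obtain x j n where u: "u = x * n" "(j, n) \<in> E" "x \<in> ideal_pow I (k + c - j)" by blast
      have "n \<in> J j" using E(2) u(2) by blast
      then obtain z where z: "n = g * z" unfolding J_def by blast
      have "x \<in> ideal_pow I k"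
        by (rule subsetD[OF ideal_pow_antimono u(3)]) (use c[OF u(2)] in simp)
      then have "x * z \<in> ideal_pow I k" by (rule is_ideal_mult_right[OF is_ideal_pow])
      moreover have "u = (x * z) * g" using u(1) z by (simp add: ac_simps)
      ultimately show "u \<in> L" unfolding L_def by blast
    qed
    ultimately have "J (k + c) \<subseteq> L"
      by (rule order_trans[OF gen[rule_format, of "k + c"] ideal_gen_least])
    moreover have "y * g \<in> J (k + c)" using y by (simp add: J_def)
    ultimately obtain z where "y * g = z * g" "z \<in> ideal_pow I k" unfolding L_def by blast
    then show ?thesis using g by blast
  qed
  then have "\<forall>k. colon (ideal_pow I (k + c)) g \<subseteq> ideal_pow I k" by (auto simp: colon_def)
  then show ?thesis by blast
qed

section \<open>Homogeneous witnesses at a fixed prime\<close>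

lemma hom_comp_space_unique:
  fixes f :: "('v, 'k::comm_monoid_add) mpoly"
  assumes "f \<in> hom_comp_space d" "f \<in> hom_comp_space e" "f \<noteq> 0"
  shows "d = e"
  using hcomp_of_homogeneous[OF assms(1), of d] hcomp_of_homogeneous[OF assms(2), of d] assms(3)
  by (simp split: if_splits)

lemma prime_idealD:
  assumes "prime_ideal P"
  shows "is_ideal P" "1 \<notin> P" "\<And>f g. f * g \<in> P \<Longrightarrow> f \<in> P \<or> g \<in> P"
proof -
  show P: "is_ideal P" "\<And>f g. f * g \<in> P \<Longrightarrow> f \<in> P \<or> g \<in> P"
    using assms by (auto simp: prime_ideal_def)
  show "1 \<notin> P" using is_ideal_mult_left[OF P(1), of 1] assms by (auto simp: prime_ideal_def)
qed

text \<open>The contraction of the extension of J to the localisation at P. Primality makes the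
  complement of P multiplicative, which gives a common multiplier for sums.\<close>

lemma is_ideal_prime_saturation:
  assumes P: "prime_ideal P" and J: "is_ideal J"
  shows "is_ideal {y. \<exists>s. s \<notin> P \<and> s * y \<in> J}"
  unfolding is_ideal_def
proof (intro conjI ballI allI)
  show "0 \<in> {y. \<exists>s. s \<notin> P \<and> s * y \<in> J}"
    using prime_idealD(2)[OF P] is_ideal_0[OF J] by (auto intro: exI[of _ 1])
next
  fix x y assume "x \<in> {y. \<exists>s. s \<notin> P \<and> s * y \<in> J}" "y \<in> {y. \<exists>s. s \<notin> P \<and> s * y \<in> J}"
  then obtain s t where st: "s \<notin> P" "t \<notin> P" "s * x \<in> J" "t * y \<in> J" by blast
  have "s * t \<notin> P" using prime_idealD(3)[OF P] st by blast
  moreover have "(s * t) * (x + y) = t * (s * x) + s * (t * y)" by (simp add: algebra_simps)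
  then have "(s * t) * (x + y) \<in> J"
    using is_ideal_add[OF J is_ideal_mult_left[OF J st(3), of t] is_ideal_mult_left[OF J st(4), of s]]
    by simp
  ultimately show "x + y \<in> {y. \<exists>s. s \<notin> P \<and> s * y \<in> J}" by blast
next
  fix x a assume "x \<in> {y. \<exists>s. s \<notin> P \<and> s * y \<in> J}"
  then obtain s where s: "s \<notin> P" "s * x \<in> J" by blast
  have "s * (a * x) \<in> J" using is_ideal_mult_left[OF J s(2), of a] by (simp add: mult.left_commute)
  then show "a * x \<in> {y. \<exists>s. s \<notin> P \<and> s * y \<in> J}" using s(1) by blast
qed

lemma colon_eq_prime_iff:
  "colon J f = P \<longleftrightarrow> (\<forall>p\<in>P. p * f \<in> J) \<and> \<not> (\<exists>s. s \<notin> P \<and> s * f \<in> J)"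
  by (auto simp: colon_def)

lemma homogeneous_colon_eventually_linear:
  fixes I P :: "('v::finite, 'k::field) mpoly set"
  assumes G: "finite G" "\<forall>g\<in>G. \<exists>e. g \<in> hom_comp_space e" and I: "I = ideal_gen G"
    and P: "prime_ideal P" "homogeneous_ideal P"
    and c: "\<And>k. {y. \<forall>p\<in>P. p * y \<in> ideal_pow I (k + c)} \<subseteq> ideal_pow I k"
  shows "eventually_linear_min (\<lambda>k. {d. \<exists>f\<in>hom_comp_space d. colon (ideal_pow I k) f = P})"
proof (rule eventually_linear_min_shift[where c = c])
  \<comment> \<open>Index k stands for the power k + c, so that N k lies in I^k.\<close>
  define N where "N k = {y. \<forall>p\<in>P. p * y \<in> ideal_pow I (k + c)}" for k
  define Q where "Q k = {y. \<exists>s. s \<notin> P \<and> s * y \<in> ideal_pow I (k + c)}" for k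
  have colon_iff: "colon (ideal_pow I (k + c)) f = P \<longleftrightarrow> f \<in> N k \<and> f \<notin> Q k" for k f
    by (simp add: colon_eq_prime_iff N_def Q_def)
  have Q: "is_ideal (Q k)" for k
    unfolding Q_def by (rule is_ideal_prime_saturation[OF P(1) is_ideal_pow])
  have N: "is_ideal (N k)" "N k \<subseteq> ideal_pow I k" "homogeneous_ideal (N k)" for k
    using is_ideal_colon_set[OF is_ideal_pow] c
      homogeneous_ideal_colon_set[OF homogeneous_ideal_pow[OF G(2) I] P(2)]
    unfolding N_def by blast+
  have N_mult: "x * y \<in> N (i + k)" if "x \<in> ideal_pow I i" "y \<in> N k" for i k x y
  proof -
    have "p * (x * y) \<in> ideal_pow I (i + k + c)" if "p \<in> P" for p
      using ideal_pow_mult[OF \<open>x \<in> ideal_pow I i\<close>, of "p * y" "k + c"] that \<open>y \<in> N k\<close>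
      by (simp add: N_def mult.left_commute add.assoc)
    then show ?thesis by (simp add: N_def)
  qed
  have Q_mult: "x * y \<in> Q (i + k)" if xy: "x \<in> ideal_pow I i" "y \<in> Q k" for i k x y
  proof -
    obtain s where s: "s \<notin> P" "s * y \<in> ideal_pow I (k + c)" using xy(2) unfolding Q_def by blast
    have "s * (x * y) \<in> ideal_pow I (i + k + c)"
      using ideal_pow_mult[OF xy(1) s(2)] by (simp add: mult.left_commute add.assoc)
    then show ?thesis unfolding Q_def using s(1) by blast
  qed
  have "\<forall>i k. \<forall>x\<in>ideal_pow I i. \<forall>y\<in>N k. x * y \<in> N (i + k)" using N_mult by blast
  from graded_family_finitely_generated[OF noetherian_rees_mpoly[OF I G(1)] N(1,2) this]
  obtain E0 where E0: "finite E0" "\<forall>(j, n)\<in>E0. n \<in> N j"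
    and gen: "\<forall>k. N k \<subseteq> ideal_gen {x * n | x j n. (j, n) \<in> E0 \<and> j \<le> k \<and> x \<in> ideal_pow I (k - j)}"
    by (elim exE conjE) (rule that)
  \<comment> \<open>The generators are split into components, which stay in N because N is
    homogeneous; the first entry keeps the level.\<close>
  define E where "E = (\<Union>e\<in>E0. Pair (fst e) ` range (\<lambda>d. hcomp d (snd e)))"
  have "finite E" unfolding E_def using E0(1) finite_range_hcomp by blast
  have E_N: "snd e \<in> N (fst e)" if "e \<in> E" for e
    using that E0(2) N(3) unfolding E_def homogeneous_ideal_def by fastforce
  have "\<exists>d. snd e \<in> hom_comp_space d" if "e \<in> E" for e
    using that hcomp_homogeneous unfolding E_def by fastforce
  then obtain edeg where edeg: "\<And>e. e \<in> E \<Longrightarrow> snd e \<in> hom_comp_space (edeg e)" by metis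
  obtain deg where deg: "\<And>g. g \<in> G \<Longrightarrow> g \<in> hom_comp_space (deg g)" using G(2) by metis
  define wt where "wt A e = sum_mset (image_mset deg A) + edeg e" for A e
  have wt: "prod_mset A * snd e \<in> hom_comp_space (wt A e)" if "set_mset A \<subseteq> G" "e \<in> E" for A e
    unfolding wt_def using that deg edeg
    by (intro hom_comp_space_mult prod_mset_homogeneous) auto
  have "G \<subseteq> I" using I subset_ideal_gen by blast
  then have prod_pow: "prod_mset A \<in> ideal_pow I (size A)" if "set_mset A \<subseteq> G" for A
    using that by (intro prod_mset_in_ideal_pow) auto
  \<comment> \<open>Only avoidance of Q selects pairs, since every product of this shape lies in N
    at its level.\<close>
  define W where "W = {(A, e). set_mset A \<subseteq> G \<and> e \<in> E \<and> prod_mset A * snd e \<notin> Q (size A + fst e)}"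
  \<comment> \<open>If the smaller product were in Q, multiplying by the removed factors, a product
    in I^(size C), would put the larger one into Q at its own level.\<close>
  have down: "(B, e) \<in> W" if Ae: "(A, e) \<in> W" and BA: "B \<subseteq># A" for A B e
  proof -
    obtain C where A: "A = B + C" using BA by (metis subset_mset.le_iff_add)
    have W: "set_mset A \<subseteq> G" "e \<in> E" "prod_mset A * snd e \<notin> Q (size A + fst e)"
      using Ae by (auto simp: W_def)
    have "prod_mset B * snd e \<notin> Q (size B + fst e)"
    proof
      assume BQ: "prod_mset B * snd e \<in> Q (size B + fst e)"
      have "set_mset C \<subseteq> G" using W(1) A by simp
      from Q_mult[OF prod_pow[OF this] BQ]
      have "prod_mset C * (prod_mset B * snd e) \<in> Q (size C + (size B + fst e))" .
      then show False using W(3) by (simp add: A ac_simps)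
    qed
    then show ?thesis using W A by (auto simp: W_def)
  qed
  define D where "D k = {wt A e | A e. (A, e) \<in> W \<and> size A + fst e = k}" for k
  have "eventually_linear_min D"
    unfolding D_def wt_def
    by (rule eventually_linear_min_downclosed[OF G(1) \<open>finite E\<close> _ down]) (auto simp: W_def)
  then show "eventually_linear_min (\<lambda>k. {d. \<exists>f\<in>hom_comp_space d. colon (ideal_pow I (k + c)) f = P})"
  proof (rule eventually_linear_min_cofinal)
    fix k
    show "D k \<subseteq> {d. \<exists>f\<in>hom_comp_space d. colon (ideal_pow I (k + c)) f = P}"
    proof
      fix d assume "d \<in> D k"
      then obtain A e where A: "d = wt A e" "set_mset A \<subseteq> G" "e \<in> E"
        "prod_mset A * snd e \<notin> Q k" "size A + fst e = k"
        unfolding D_def W_def by blast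
      have "prod_mset A * snd e \<in> N k"
        using N_mult[OF prod_pow[OF A(2)] E_N[OF A(3)]] A(5) by simp
      then show "d \<in> {d. \<exists>f\<in>hom_comp_space d. colon (ideal_pow I (k + c)) f = P}"
        using wt[OF A(2,3)] A(1,4) colon_iff[of k] by blast
    qed
  next
    fix k d assume "d \<in> {d. \<exists>f\<in>hom_comp_space d. colon (ideal_pow I (k + c)) f = P}"
    then obtain f where f: "f \<in> hom_comp_space d" "f \<in> N k" "f \<notin> Q k"
      using colon_iff[of k] by blast
    \<comment> \<open>All products at level k, inside Q or not, so that they generate an ideal
      containing N k.\<close>
    define H where "H = {prod_mset A * snd e | A e. set_mset A \<subseteq> G \<and> e \<in> E \<and> size A + fst e = k}"
    have "{x * n | x j n. (j, n) \<in> E0 \<and> j \<le> k \<and> x \<in> ideal_pow I (k - j)} \<subseteq> ideal_gen H"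
    proof
      fix u assume "u \<in> {x * n | x j n. (j, n) \<in> E0 \<and> j \<le> k \<and> x \<in> ideal_pow I (k - j)}"
      then obtain x j n where u: "u = x * n" "(j, n) \<in> E0" "j \<le> k" "x \<in> ideal_pow I (k - j)" by blast
      have x: "x \<in> ideal_gen {prod_mset A | A. set_mset A \<subseteq> G \<and> size A = k - j}"
        using u(4) ideal_pow_generators[OF I] by simp
      have n: "n \<in> ideal_gen (range (\<lambda>d. hcomp d n))"
        by (rule in_ideal_if_hcomp[OF is_ideal_ideal_gen], rule ideal_gen_base) simp
      show "u \<in> ideal_gen H"
        unfolding u(1)
      proof (rule ideal_gen_mult[OF x n is_ideal_ideal_gen], rule ideal_gen_base)
        fix a b assume "a \<in> {prod_mset A | A. set_mset A \<subseteq> G \<and> size A = k - j}"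
          and b: "b \<in> range (\<lambda>d. hcomp d n)"
        then obtain A where A: "a = prod_mset A" "set_mset A \<subseteq> G" "size A = k - j" by blast
        have "(j, b) \<in> E" unfolding E_def using u(2) b by force
        moreover have "size A + fst (j, b) = k" "a * b = prod_mset A * snd (j, b)"
          using A u(3) by simp_all
        ultimately show "a * b \<in> H" unfolding H_def using A(2) by blast
      qed
    qed
    then have "N k \<subseteq> ideal_gen H"
      by (rule order_trans[OF gen[rule_format, of k] ideal_gen_least[OF is_ideal_ideal_gen]])
    then have "f \<in> ideal_gen H" using f(2) by blast
    moreover have "\<exists>e. h \<in> hom_comp_space e" if "h \<in> H" for h
      using that wt unfolding H_def by blast
    ultimately have "hcomp d f \<in> ideal_gen {h \<in> H. \<exists>e\<le>d. h \<in> hom_comp_space e}"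
      by (intro hcomp_in_ideal_gen)
    then have "f \<in> ideal_gen {h \<in> H. \<exists>e\<le>d. h \<in> hom_comp_space e}"
      using hcomp_of_homogeneous[OF f(1), of d] by simp
    \<comment> \<open>The ideal Q k omits f, so it cannot contain all the products of degree at most
      d, which generate f.\<close>
    then have "\<not> {h \<in> H. \<exists>e\<le>d. h \<in> hom_comp_space e} \<subseteq> Q k"
      using ideal_gen_least[OF Q[of k]] f(3) by blast
    then obtain h e' where h: "h \<in> H" "e' \<le> d" "h \<in> hom_comp_space e'" "h \<notin> Q k" by blast
    then obtain A e where A: "h = prod_mset A * snd e" "set_mset A \<subseteq> G" "e \<in> E" "size A + fst e = k"
      unfolding H_def by blast
    \<comment> \<open>Zero is homogeneous of every degree, and \<open>edeg\<close> is an arbitrary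
      choice on zero components; only for nonzero h is \<open>wt A e\<close> forced to equal its
      degree.\<close>
    have "h \<noteq> 0" using h(4) is_ideal_0[OF Q] by auto
    then have "wt A e = e'" using hom_comp_space_unique wt[OF A(2,3)] A(1) h(3) by blast
    moreover have "(A, e) \<in> W" using A h(4) by (simp add: W_def)
    ultimately show "\<exists>d'\<in>D k. d' \<le> d" using A(4) h(2) unfolding D_def by blast
  qed
qed

text \<open>For g in I the power g^k lies in I^k, hence in (I^k : f) = P, and P is prime.\<close>

lemma ideal_subset_prime_colon:
  assumes P: "prime_ideal P" "colon (ideal_pow I k) f = P"
  shows "I \<subseteq> P"
proof
  fix g assume g: "g \<in> I"
  have "prod_list (replicate k g) \<in> ideal_pow I k"
    using prod_list_in_ideal_pow[of "replicate k g" I] g by (auto simp: set_replicate_conv_if)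
  then have "g ^ k \<in> P"
    using P(2) is_ideal_mult_right[OF is_ideal_pow] by (auto simp: colon_def)
  then show "g \<in> P"
    by (induction k) (use prime_idealD[OF P(1)] in auto)
qed

text \<open>The sum of the I^(k+c) t^k is an ideal J of the Rees algebra. If (I^(k+c) : f) = P, then
  g lies in P, so f is in I^k by the choice of c. Hence f t^k is in the Rees algebra and P is the
  contraction of (J : f t^k).\<close>

lemma finite_prime_colons:
  fixes I :: "'a::comm_ring_1 set"
  assumes noeth: "noetherian_set (rees I)" and g: "g \<in> I"
    and c: "\<And>k. colon (ideal_pow I (k + c)) g \<subseteq> ideal_pow I k"
  shows "finite {P. prime_ideal P \<and> (\<exists>k\<ge>c. \<exists>f. colon (ideal_pow I k) f = P)}"
proof -
  define J where "J = {p. \<forall>k. coeff p k \<in> ideal_pow I (k + c)}"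
  have "ideal_pow I (k + c) \<subseteq> ideal_pow I k" for k by (simp add: ideal_pow_antimono)
  then have "J \<subseteq> rees I" unfolding J_def rees_def by blast
  moreover have "submodule_of (rees I) J"
    unfolding submodule_of_def
  proof (intro conjI ballI)
    fix p q assume pq: "p \<in> rees I" "q \<in> J"
    have "coeff p i * coeff q (k - i) \<in> ideal_pow I (k + c)" if "i \<le> k" for i k
    proof -
      have "coeff p i \<in> ideal_pow I i" "coeff q (k - i) \<in> ideal_pow I (k - i + c)"
        using pq by (simp_all only: rees_def J_def mem_Collect_eq)
      from ideal_pow_mult[OF this] show ?thesis using that by simp
    qed
    then show "p * q \<in> J"
      unfolding J_def mem_Collect_eq coeff_mult by (intro allI is_ideal_sum[OF is_ideal_pow]) simp
  qed (auto simp: J_def is_ideal_0[OF is_ideal_pow] is_ideal_add[OF is_ideal_pow])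
  ultimately have "finite {P. prime_ideal P \<and> (\<exists>y\<in>rees I. P = {s. [:s:] * y \<in> J})}"
    by (rule finite_contracted_ass[OF subring_set_rees const_in_rees noeth])
  moreover have "{P. prime_ideal P \<and> (\<exists>k\<ge>c. \<exists>f. colon (ideal_pow I k) f = P)} \<subseteq>
      {P. prime_ideal P \<and> (\<exists>y\<in>rees I. P = {s. [:s:] * y \<in> J})}"
  proof
    fix P assume "P \<in> {P. prime_ideal P \<and> (\<exists>k\<ge>c. \<exists>f. colon (ideal_pow I k) f = P)}"
    then obtain k' f where P: "prime_ideal P" "k' \<ge> c" "colon (ideal_pow I k') f = P" by blast
    define k where "k = k' - c"
    have f: "colon (ideal_pow I (k + c)) f = P" using P(2,3) by (simp add: k_def)
    have "g \<in> P" using ideal_subset_prime_colon[OF P(1) f] g by blast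
    then have "f \<in> colon (ideal_pow I (k + c)) g" using f by (auto simp: colon_def mult.commute)
    then have "monom f k \<in> rees I" using c by (intro monom_in_rees) blast
    moreover have "[:s:] * monom f k \<in> J \<longleftrightarrow> s * f \<in> ideal_pow I (k + c)" for s
      by (auto simp: J_def smult_monom is_ideal_0[OF is_ideal_pow])
    then have "P = {s. [:s:] * monom f k \<in> J}" using f by (simp add: colon_def)
    ultimately show "P \<in> {P. prime_ideal P \<and> (\<exists>y\<in>rees I. P = {s. [:s:] * y \<in> J})}"
      using P(1) by blast
  qed
  ultimately show ?thesis by (rule finite_subset[rotated])
qed

theorem theorem3p1:
  fixes I :: "('v::finite, 'k::field) mpoly set"
  assumes "graded_ideal I" and "I \<noteq> {0}" and "I \<noteq> UNIV"
  shows "(\<forall>P \<in> Ass_inf I. \<exists>a b :: int. \<exists>k0. \<forall>k\<ge>k0.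
            int (v_number_at (ideal_pow I k) P) = a * int k + b)
       \<and> (\<exists>a b :: int. \<exists>k0. \<forall>k\<ge>k0. int (v_number (ideal_pow I k)) = a * int k + b)"
proof -
  obtain G where G: "finite G" "\<forall>g\<in>G. \<exists>e. g \<in> hom_comp_space e" and I: "I = ideal_gen G"
    using graded_ideal_generators[OF assms(1)] by blast
  note noeth = noetherian_rees_mpoly[OF I G(1)]
  have "0 \<in> I" using I is_ideal_0[OF is_ideal_ideal_gen] by blast
  then obtain g where g: "g \<in> I" "g \<noteq> 0" using assms(2) by blast
  have "x = y" if "x * g = y * g" for x y
    using mpoly_no_zero_divisors[of "x - y" g] that g(2) by (simp add: left_diff_distrib)
  then obtain c where c: "\<And>k. colon (ideal_pow I (k + c)) g \<subseteq> ideal_pow I k"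
    using artin_rees_colon[OF noeth] by metis
  define V where "V P k = {d. \<exists>f\<in>hom_comp_space d. colon (ideal_pow I k) f = P}" for P k
  have V: "eventually_linear_min (V P)" if P: "prime_ideal P" "I \<subseteq> P" for P
  proof (cases "homogeneous_ideal P")
    case True
    have "{y. \<forall>p\<in>P. p * y \<in> ideal_pow I (k + c)} \<subseteq> ideal_pow I k" for k
      using c[of k] P(2) g(1) by (auto simp: colon_def mult.commute)
    then show ?thesis
      unfolding V_def[abs_def] by (rule homogeneous_colon_eventually_linear[OF G I P(1) True])
  next
    case False
    \<comment> \<open>The colon by a homogeneous f is homogeneous, so a prime that is not
      homogeneous has no homogeneous witness.\<close>
    then have "V P k = {}" for k
      unfolding V_def using homogeneous_ideal_colon[OF homogeneous_ideal_pow[OF G(2) I]] by blast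
    then show ?thesis by (simp add: eventually_linear_min_def)
  qed
  define F where "F = {P. prime_ideal P \<and> (\<exists>k\<ge>c. \<exists>f. colon (ideal_pow I k) f = P)}"
  have "finite F" unfolding F_def by (rule finite_prime_colons[OF noeth g(1) c])
  have "eventually_linear_min (V P)" if "P \<in> F" for P
    using that V ideal_subset_prime_colon unfolding F_def by blast
  then have "eventually_linear_min (\<lambda>k. \<Union>P\<in>F. V P k)"
    using eventually_linear_min_UN[OF \<open>finite F\<close>] by blast
  \<comment> \<open>F collects primes over all powers from c on; at a given k, those without a
    homogeneous witness contribute the empty set.\<close>
  moreover have "{d. \<exists>f\<in>hom_comp_space d. colon (ideal_pow I k) f \<in> Ass (ideal_pow I k)} =
      (\<Union>P\<in>F. V P k)" if "k \<ge> c" for k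
    using that by (auto simp: F_def V_def Ass_def)
  ultimately have "eventually_linear_min
      (\<lambda>k. {d. \<exists>f\<in>hom_comp_space d. colon (ideal_pow I k) f \<in> Ass (ideal_pow I k)})"
    by (rule eventually_linear_min_cong)
  from eventually_linear_minD[OF this]
  have "\<exists>a b :: int. \<exists>k0. \<forall>k\<ge>k0. int (v_number (ideal_pow I k)) = a * int k + b"
    by (simp add: v_number_def)
  moreover have "\<exists>a b :: int. \<exists>k0. \<forall>k\<ge>k0. int (v_number_at (ideal_pow I k) P) = a * int k + b"
    if P: "P \<in> Ass_inf I" for P
  proof -
    \<comment> \<open>A single power is enough to place I inside P; \<open>V\<close> then covers all
      large k.\<close>
    obtain k f where "prime_ideal P" "colon (ideal_pow I k) f = P"
      using P unfolding Ass_inf_def Ass_def by blast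
    then have "eventually_linear_min (V P)" using V ideal_subset_prime_colon by blast
    from eventually_linear_minD[OF this] show ?thesis
      by (simp add: v_number_at_def V_def)
  qed
  ultimately show ?thesis by blast
qed

end
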